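(* Consider the multi-server speed-scaling problem described in the context, with a power function $P$ satisfying: (A1) $P:\mathbb{R}_+\to\mathbb{R}_+$, $P(0)=0$, $P$ is differentiable, strictly increasing and strictly convex, and $\bar{s}:=\inf\{s>0 : P(s)>s\}<\infty$; (A2) $P(xy)\le P(x)P(y)$ for all $x,y>0$. Consider the online algorithm that at every time $t$ serves, on $\min\{m,n(t)\}$ distinct servers, the $\min\{m,n(t)\}$ unfinished jobs with the shortest remaining sizes (SRPT, with migration allowed), where $n(t)$ is the number of unfinished jobs at time $t$; each busy server runs at speed $P^{-1}(n(t)/m)$ if $n(t)\ge m$ and at speed $P^{-1}(1)$ if $n(t)<m$, and idle servers run at speed $0$. Then this algorithm is $c$-competitive, where $$c = P(2-1/m)\left(2+\frac{2}{P^{-1}(1)}\max(1,P(\bar{s}))\right).$$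
   Context: There are $m$ identical servers, each of which can run at any speed $s\ge 0$ at power consumption $P(s)$; work is processed at rate $s$. A (finite) input instance $\sigma$ consists of jobs $j$ with release times $a_j$ and sizes $w_j>0$. Preemption is allowed, and migration is allowed (a preempted job may be resumed on any server), but a job may be processed by at most one server at any time. Job $j$ completes at time $c_j$ when $w_j$ units of work have been done on it. The cost of a schedule is $C=\int n(t)\,dt+\int\sum_{k=1}^m P(s_k(t))\,dt$, where $n(t)$ is the number of released, unfinished jobs at time $t$ and $s_k(t)$ is the speed of server $k$ (i.e., total flow time plus energy). An online algorithm learns of job $j$ only at time $a_j$. $\mathsf{OPT}$ denotes the offline optimal schedule, which knows $\sigma$ in advance and minimizes $C$. An online algorithm $A$ is $c$-competitive if $C_A(\sigma)\le c\,C_{\mathsf{OPT}}(\sigma)$ for every input instance $\sigma$. *)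

theory Defs
  imports "HOL-Analysis.Analysis"
begin

definition strictly_convex_on :: "real set \<Rightarrow> (real \<Rightarrow> real) \<Rightarrow> bool" where
  "strictly_convex_on S f \<longleftrightarrow>
     (\<forall>x\<in>S. \<forall>y\<in>S. \<forall>u::real. x \<noteq> y \<and> 0 < u \<and> u < 1 \<longrightarrow>
        f (u * x + (1 - u) * y) < u * f x + (1 - u) * f y)"

definition power_fun_ok :: "(real \<Rightarrow> real) \<Rightarrow> bool" where
  "power_fun_ok P \<longleftrightarrow>
     (\<forall>s\<ge>0. P s \<ge> 0) \<and> P 0 = 0 \<and>
     (\<forall>s\<ge>0. P differentiable (at s within {0..})) \<and>
     strict_mono_on {0..} P \<and>
     strictly_convex_on {0..} P \<and>
     (\<exists>s>0. P s > s) \<and>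
     (\<forall>x>0. \<forall>y>0. P (x * y) \<le> P x * P y)"

definition sbar :: "(real \<Rightarrow> real) \<Rightarrow> real" where
  "sbar P = Inf {s. s > 0 \<and> P s > s}"

definition Pinv :: "(real \<Rightarrow> real) \<Rightarrow> real \<Rightarrow> real" where
  "Pinv P y = (THE s. s \<ge> 0 \<and> P s = y)"

text \<open>A schedule on m servers (indexed 0..<m) is given by server speeds
  sp k t and assignments asg k t (the job run on server k at time t, if any).
  Rate at which job j is processed at time t:\<close>
definition rate :: "nat \<Rightarrow> (nat \<Rightarrow> real \<Rightarrow> real) \<Rightarrow> (nat \<Rightarrow> real \<Rightarrow> 'j option) \<Rightarrow> 'j \<Rightarrow> real \<Rightarrow> real" where
  "rate m sp asg j t = (\<Sum>k<m. if asg k t = Some j then sp k t else 0)"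

definition done_work :: "nat \<Rightarrow> ('j \<Rightarrow> real) \<Rightarrow> (nat \<Rightarrow> real \<Rightarrow> real) \<Rightarrow> (nat \<Rightarrow> real \<Rightarrow> 'j option) \<Rightarrow> 'j \<Rightarrow> real \<Rightarrow> ennreal" where
  "done_work m a sp asg j t = (\<integral>\<^sup>+ \<tau> \<in> {a j..t}. ennreal (rate m sp asg j \<tau>) \<partial>lborel)"

definition unfinished :: "nat \<Rightarrow> 'j set \<Rightarrow> ('j \<Rightarrow> real) \<Rightarrow> ('j \<Rightarrow> real) \<Rightarrow> (nat \<Rightarrow> real \<Rightarrow> real) \<Rightarrow> (nat \<Rightarrow> real \<Rightarrow> 'j option) \<Rightarrow> real \<Rightarrow> 'j set" where
  "unfinished m J a w sp asg t = {j \<in> J. a j \<le> t \<and> done_work m a sp asg j t < ennreal (w j)}"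

definition remaining :: "nat \<Rightarrow> ('j \<Rightarrow> real) \<Rightarrow> ('j \<Rightarrow> real) \<Rightarrow> (nat \<Rightarrow> real \<Rightarrow> real) \<Rightarrow> (nat \<Rightarrow> real \<Rightarrow> 'j option) \<Rightarrow> 'j \<Rightarrow> real \<Rightarrow> real" where
  "remaining m a w sp asg j t = w j - enn2real (done_work m a sp asg j t)"

definition feasible :: "nat \<Rightarrow> 'j set \<Rightarrow> ('j \<Rightarrow> real) \<Rightarrow> (nat \<Rightarrow> real \<Rightarrow> real) \<Rightarrow> (nat \<Rightarrow> real \<Rightarrow> 'j option) \<Rightarrow> bool" where
  "feasible m J a sp asg \<longleftrightarrow>
     (\<forall>k<m. \<forall>t. sp k t \<ge> 0) \<and>
     (\<forall>k<m. sp k \<in> borel_measurable lborel) \<and>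
     (\<forall>k<m. \<forall>j. {t. asg k t = Some j} \<in> sets lborel) \<and>
     (\<forall>k<m. \<forall>t j. asg k t = Some j \<longrightarrow> j \<in> J \<and> a j \<le> t) \<and>
     (\<forall>t. \<forall>k<m. \<forall>k'<m. asg k t \<noteq> None \<and> asg k t = asg k' t \<longrightarrow> k = k')"

definition cost :: "(real \<Rightarrow> real) \<Rightarrow> nat \<Rightarrow> 'j set \<Rightarrow> ('j \<Rightarrow> real) \<Rightarrow> ('j \<Rightarrow> real) \<Rightarrow> (nat \<Rightarrow> real \<Rightarrow> real) \<Rightarrow> (nat \<Rightarrow> real \<Rightarrow> 'j option) \<Rightarrow> ennreal" where
  "cost P m J a w sp asg =
     (\<integral>\<^sup>+ t. ennreal (real (card (unfinished m J a w sp asg t))) \<partial>lborel) +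
     (\<integral>\<^sup>+ t. ennreal (\<Sum>k<m. P (sp k t)) \<partial>lborel)"

text \<open>Schedules produced by the online algorithm: SRPT on min(m, n(t)) distinct servers,
  busy servers at speed Pinv (n/m) if n \<ge> m and Pinv 1 otherwise, idle servers at speed 0.
  (Ties among equal remaining sizes may be broken arbitrarily.)\<close>
definition alg_schedule :: "(real \<Rightarrow> real) \<Rightarrow> nat \<Rightarrow> 'j set \<Rightarrow> ('j \<Rightarrow> real) \<Rightarrow> ('j \<Rightarrow> real) \<Rightarrow> (nat \<Rightarrow> real \<Rightarrow> real) \<Rightarrow> (nat \<Rightarrow> real \<Rightarrow> 'j option) \<Rightarrow> bool" where
  "alg_schedule P m J a w sp asg \<longleftrightarrow>
     feasible m J a sp asg \<and>
     (\<forall>t. let U = unfinished m J a w sp asg t; n = card U;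
              Srv = {j. \<exists>k<m. asg k t = Some j} in
          Srv \<subseteq> U \<and> card Srv = min m n \<and>
          (\<forall>j\<in>Srv. \<forall>i\<in>U - Srv. remaining m a w sp asg j t \<le> remaining m a w sp asg i t) \<and>
          (\<forall>k<m. (asg k t = None \<longrightarrow> sp k t = 0) \<and>
                 (asg k t \<noteq> None \<longrightarrow>
                    sp k t = (if n \<ge> m then Pinv P (real n / real m) else Pinv P 1))))"

end

theory Submission
  imports Defs
begin

text \<open>
  At every moment the power drawn by the algorithm equals its number \<open>n\<close> of unfinished jobs, so its cost
  is \<open>2 \<integral> n\<close>. Write \<open>C\<close> for the cost of an arbitrary competing schedule with \<open>n'\<close> unfinished jobs
  and total speed \<open>S\<close>, and \<open>A = P (2 - 1/m)\<close>. Since \<open>s \<le> 1 + P s\<close>, the total size of all jobs is at most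
  \<open>C\<close>; hence it suffices that \<open>\<integral> n\<close> is at most \<open>A C\<close> plus \<open>A / P\<inverse>(1)\<close> times the total work of the algorithm.

  Let \<open>T i\<close> be the remaining work of a schedule outside its \<open>i\<close> largest jobs and let \<open>X k\<close> be the
  largest excess of \<open>T (i + k)\<close> of the algorithm over \<open>T i\<close> of the competitor. The potential is
  \<open>\<Sum>k. (\<Delta> (k + 1) - \<Delta> k) X k\<close> for a suitable nondecreasing \<open>\<Delta>\<close>. Releases never increase any \<open>X k\<close>.
  While \<open>n\<close> and \<open>n'\<close> are constant, SRPT at speed \<open>s\<close> decreases \<open>T i\<close> at rate \<open>s min(m, n - i)\<close>, whereas
  the competitor, whichever jobs it runs, decreases its \<open>T i\<close> at rate at most \<open>S\<close>. Hence no assumption on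
  the order in which the competitor serves its jobs is required, and only the mean of \<open>S\<close> between
  two events matters, which convexity of \<open>P\<close> turns into a bound on the energy.
\<close>

section \<open>Power functions and amortization weights\<close>

locale power_function =
  fixes P :: "real \<Rightarrow> real"
  assumes power_fun_ok: "power_fun_ok P"
begin

lemma P_nonneg: "0 \<le> s \<Longrightarrow> 0 \<le> P s"
  and P_zero: "P 0 = 0"
  and P_submult: "0 < x \<Longrightarrow> 0 < y \<Longrightarrow> P (x * y) \<le> P x * P y"
  using power_fun_ok by (auto simp: power_fun_ok_def)

lemma P_strict_mono: "0 \<le> x \<Longrightarrow> x < y \<Longrightarrow> P x < P y"
  using power_fun_ok by (auto simp: power_fun_ok_def strict_mono_on_def)

lemma P_mono: "0 \<le> x \<Longrightarrow> x \<le> y \<Longrightarrow> P x \<le> P y"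
  using P_strict_mono[of x y] by (cases "x = y") auto

lemma P_pos: "0 < x \<Longrightarrow> 0 < P x"
  using P_strict_mono[of 0 x] P_zero by auto

lemma P_convex: "convex_on {0..} P"
proof (rule convex_onI)
  fix t x y :: real
  assume "0 < t" "t < 1" "x \<in> {0..}" "y \<in> {0..}"
  moreover have "strictly_convex_on {0..} P" using power_fun_ok by (auto simp: power_fun_ok_def)
  ultimately have "x \<noteq> y \<Longrightarrow> P ((1 - t) * x + (1 - (1 - t)) * y) < (1 - t) * P x + (1 - (1 - t)) * P y"
    unfolding strictly_convex_on_def
    by (metis diff_gt_0_iff_gt diff_less_eq less_add_same_cancel1)
  then show "P ((1 - t) *\<^sub>R x + t *\<^sub>R y) \<le> (1 - t) * P x + t * P y"
    by (cases "x = y") (auto simp: algebra_simps)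
qed auto

lemma P_continuous: "continuous_on {0..} P"
  using power_fun_ok
  by (auto simp: power_fun_ok_def differentiable_on_def intro!: differentiable_imp_continuous_on)

lemma P_scale_le: "0 \<le> u \<Longrightarrow> u \<le> 1 \<Longrightarrow> 0 \<le> x \<Longrightarrow> P (u * x) \<le> u * P x"
  using convex_onD[OF P_convex, of u 0 x] P_zero by (auto simp: algebra_simps)

lemma P_scale_ge:
  assumes "1 \<le> u" "0 \<le> x"
  shows "u * P x \<le> P (u * x)"
proof -
  have "P (1 / u * (u * x)) \<le> 1 / u * P (u * x)"
    using assms by (intro P_scale_le) auto
  then show ?thesis using assms by (simp add: field_simps)
qed

text \<open>Submultiplicativity at 1 reads \<open>P 1 \<le> P 1 * P 1\<close>. This fixes the scale
  of \<open>P\<close>: with convexity it gives \<open>s \<le> P s\<close> for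
  \<open>s \<ge> 1\<close>, the source of all later bounds of speed by power.\<close>

lemma P_one_ge: "1 \<le> P 1"
  using P_submult[of 1 1] P_pos[of 1] by (simp add: mult_le_cancel_left1)

lemma P_ge:
  assumes "1 \<le> s"
  shows "s \<le> P s"
proof -
  have "s * 1 \<le> s * P 1" using assms P_one_ge by (intro mult_left_mono) auto
  then show ?thesis using P_scale_ge[OF assms, of 1] by simp
qed

lemma P_two_minus_ge:
  assumes "1 \<le> m"
  shows "1 \<le> P (2 - 1 / real m)"
proof -
  have "1 \<le> 2 - 1 / real m" using assms by (simp add: field_simps)
  then show ?thesis using P_ge[of "2 - 1 / real m"] by linarith
qed

lemma Pinv_ex1: "0 \<le> y \<Longrightarrow> \<exists>!s. s \<ge> 0 \<and> P s = y"
proof -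
  assume y: "0 \<le> y"
  \<comment> \<open>Intermediate values on \<open>{0..y + 1}\<close>; the right endpoint is high
    enough because \<open>P (y + 1) \<ge> y + 1\<close>.\<close>
  have "\<exists>s. 0 \<le> s \<and> s \<le> y + 1 \<and> P s = y"
    using y P_ge[of "y + 1"] P_zero by (intro IVT') (auto intro: continuous_on_subset[OF P_continuous])
  moreover have "s = s'" if "s \<ge> 0" "P s = y" "s' \<ge> 0" "P s' = y" for s s'
    using P_strict_mono[of s s'] P_strict_mono[of s' s] that by (cases s s' rule: linorder_cases) auto
  ultimately show ?thesis by blast
qed

lemma P_Pinv: "0 \<le> y \<Longrightarrow> P (Pinv P y) = y"
  and Pinv_nonneg: "0 \<le> y \<Longrightarrow> 0 \<le> Pinv P y"
  unfolding Pinv_def using theI'[OF Pinv_ex1, of y] by auto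

lemma Pinv_pos: "0 < y \<Longrightarrow> 0 < Pinv P y"
  using P_Pinv[of y] Pinv_nonneg[of y] P_zero by (cases "Pinv P y = 0") auto

lemma Pinv_mono: "0 \<le> x \<Longrightarrow> x \<le> y \<Longrightarrow> Pinv P x \<le> Pinv P y"
  using P_strict_mono[of "Pinv P y" "Pinv P x"] P_Pinv[of x] P_Pinv[of y] Pinv_nonneg[of y]
  by (cases "Pinv P x \<le> Pinv P y") auto

text \<open>At an interior point the tangent works, and evaluating it at 0 shows that its slope is
  nonnegative. At the boundary point 0 the slope 0 is taken, which suffices since \<open>P\<close>
  is nonnegative. The sign matters later, when slopes serve as weights and multiply extended
  nonnegative integrals.\<close>

lemma subgradient_exists: "0 \<le> x \<Longrightarrow> \<exists>g\<ge>0. \<forall>z\<ge>0. P x + g * (z - x) \<le> P z"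
proof (cases "x = 0")
  case True
  then show ?thesis using P_zero P_nonneg by (intro exI[of _ 0]) auto
next
  case False
  assume "0 \<le> x"
  with False have x: "x > 0" by simp
  have "P differentiable (at x within {0..})"
    using power_fun_ok x by (auto simp: power_fun_ok_def)
  then obtain g where g: "(P has_field_derivative g) (at x within {0..})"
    by (auto simp: real_differentiable_def)
  have *: "P x + g * (z - x) \<le> P z" if "z \<ge> 0" for z
  proof -
    have "P z - P x \<ge> g * (z - x)"
      using x that by (intro convex_on_imp_above_tangent[OF P_convex]) (auto intro: g)
    then show ?thesis by simp
  qed
  have "P x \<le> g * x" using *[of 0] P_zero by simp
  then have "0 \<le> g" using P_nonneg[of x] x by (smt (verit) mult_neg_pos)
  with * show ?thesis by auto
qed

text \<open>Submultiplicativity gives \<open>P x \<le> A * P (2/3 * x)\<close>; by convexity this keeps \<open>P\<close> above the line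
  through its values at \<open>2/3 * x\<close> and \<open>x\<close> to the left of \<open>2/3 * x\<close>.\<close>

lemma chord_bound:
  assumes x: "0 < x" and \<sigma>: "0 \<le> \<sigma>" and A: "P (3/2) \<le> A"
  shows "A * (\<sigma> * (P x / x)) \<le> A * P \<sigma> + (A - 1) * P x"
proof -
  define \<tau> where "\<tau> = \<sigma> / x"
  define B where "B = 1 - 1 / A"
  have A32: "3/2 \<le> A" using P_ge[of "3/2"] A by simp
  have Px: "0 < P x" using P_pos x by simp
  have \<sigma>_eq: "\<sigma> = \<tau> * x" and \<tau>: "0 \<le> \<tau>" using x \<sigma> by (auto simp: \<tau>_def)
  have two_thirds: "P x \<le> A * P (2/3 * x)"
  proof -
    have "P (3/2 * (2/3 * x)) \<le> P (3/2) * P (2/3 * x)" using x by (intro P_submult) auto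
    also have "\<dots> \<le> A * P (2/3 * x)" using A P_nonneg x by (intro mult_right_mono) auto
    finally show ?thesis by simp
  qed
  \<comment> \<open>The claim divided by \<open>A\<close>, with \<open>\<tau> = \<sigma> / x\<close>
    and \<open>B = (A - 1) / A\<close>.\<close>
  have key: "\<tau> * P x \<le> P \<sigma> + B * P x"
  proof -
    consider "\<tau> \<le> B" | "1 \<le> \<tau>" | "2/3 \<le> \<tau>" "\<tau> \<le> 1" | "B < \<tau>" "\<tau> < 2/3" by linarith
    then show ?thesis
    proof cases
      case 1
      then show ?thesis using P_nonneg[OF \<sigma>] Px mult_right_mono[of \<tau> B "P x"] by linarith
    next
      case 2
      have "0 \<le> B * P x" using A32 Px by (simp add: B_def)
      with P_scale_ge[OF 2, of x] x show ?thesis by (simp add: \<sigma>_eq)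
    next
      case 3
      have "P (2/3 * x) \<le> P \<sigma>" using 3 x by (intro P_mono) (auto simp: \<sigma>_eq)
      then have "A * P (2/3 * x) \<le> A * P \<sigma>" using A32 by simp
      with two_thirds have "P x \<le> A * P \<sigma>" by linarith
      then have "P x / A \<le> P \<sigma>" using A32 by (simp add: field_simps)
      moreover have "\<tau> * P x \<le> P x" using 3 Px by simp
      ultimately show ?thesis by (simp add: B_def algebra_simps)
    next
      case 4
      \<comment> \<open>The weight for which \<open>2/3 * x\<close> is the convex combination of
        \<open>x\<close> and \<open>\<sigma>\<close> with weight \<open>u\<close> on
        \<open>\<sigma>\<close>. Convexity then bounds \<open>P \<sigma>\<close> from below by the
        line through the lower bound \<open>P x / A\<close> at \<open>2/3 * x\<close> and the value
        at \<open>x\<close>.\<close>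
      define u where "u = (1/3) / (1 - \<tau>)"
      have u: "0 \<le> u" "u \<le> 1" "u * (1 - \<tau>) = 1/3" using 4 by (auto simp: u_def)
      have "P ((1 - u) * x + u * \<sigma>) \<le> (1 - u) * P x + u * P \<sigma>"
        using convex_onD[OF P_convex, of u x \<sigma>] u x \<sigma> by simp
      moreover have "(1 - u) * x + u * \<sigma> = 2/3 * x"
      proof -
        have "(1 - u) * x + u * \<sigma> = (1 - u * (1 - \<tau>)) * x" by (simp add: \<sigma>_eq algebra_simps)
        then show ?thesis using u(3) by simp
      qed
      moreover have "P x / A \<le> P (2/3 * x)" using two_thirds A32 by (simp add: field_simps)
      ultimately have "(1 - B) * P x \<le> (1 - u) * P x + u * P \<sigma>" by (simp add: B_def)
      then have "(1 - \<tau>) * ((u - B) * P x) \<le> (1 - \<tau>) * (u * P \<sigma>)"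
        using 4 by (intro mult_left_mono) (auto simp: algebra_simps)
      also have "\<dots> = P \<sigma> / 3" 
      proof -
        have "(1 - \<tau>) * (u * P \<sigma>) = (u * (1 - \<tau>)) * P \<sigma>" by (simp only: mult_ac)
        then show ?thesis unfolding u(3) by simp
      qed
      finally have "(u * (1 - \<tau>) - B * (1 - \<tau>)) * P x \<le> P \<sigma> / 3" by (simp add: algebra_simps)
      then have *: "(1 - 3 * B * (1 - \<tau>)) * P x \<le> P \<sigma>" unfolding u(3) by (simp add: algebra_simps)
      have B: "1/3 \<le> B" using A32 by (simp add: B_def field_simps)
      have "(1 - \<tau>) * (3 * B - 1) \<le> (1 - B) * (3 * B - 1)" using 4 B by (intro mult_right_mono) auto
      \<comment> \<open>Equivalent to \<open>3 * B^2 - 3 * B + 1 \<ge> 0\<close>, and the left side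
        is \<open>3/4 * (2 * B - 1)^2 + 1/4\<close>.\<close>
      also have "\<dots> \<le> B" using zero_le_power2[of "2 * B - 1"] by (simp add: power2_eq_square algebra_simps)
      finally have "\<tau> - B \<le> 1 - 3 * B * (1 - \<tau>)" by (simp add: algebra_simps)
      then have "(\<tau> - B) * P x \<le> P \<sigma>" using * Px by (smt (verit) mult_right_mono)
      then show ?thesis by (simp add: algebra_simps)
    qed
  qed
  have "A * (\<tau> * P x) \<le> A * (P \<sigma> + B * P x)" using key A32 by (intro mult_left_mono) auto
  also have "\<dots> = A * P \<sigma> + (A * B) * P x" by (simp add: algebra_simps)
  also have "A * B = A - 1" using A32 by (simp add: B_def field_simps)
  finally show ?thesis by (simp add: \<tau>_def)
qed

section \<open>Weights for the potential and their drift inequality\<close>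

definition srpt_speed :: "nat \<Rightarrow> nat \<Rightarrow> real" where
  "srpt_speed m n = (if n \<ge> m then Pinv P (real n / real m) else Pinv P 1)"

text \<open>\<open>min m (D - k)\<close> counts the \<open>l < m\<close> with
  \<open>k < D - l\<close>. After swapping the sums each inner sum telescopes; indices with
  \<open>l \<ge> D\<close> contribute \<open>\<Delta> 0 = 0\<close>.\<close>

lemma sum_increments_min:
  fixes \<Delta> :: "nat \<Rightarrow> real"
  assumes "\<Delta> 0 = 0" "D \<le> n"
  shows "(\<Sum>k<n. (\<Delta> (Suc k) - \<Delta> k) * real (min m (D - k))) = (\<Sum>l<m. \<Delta> (D - l))"
proof -
  have min_eq: "real (min m (D - k)) = (\<Sum>l<m. if k < D - l then 1 else 0)" for k
  proof -
    have "{l. l < m \<and> k < D - l} = {..<min m (D - k)}" by auto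
    then show ?thesis by (simp add: sum.If_cases Int_def)
  qed
  have "(\<Sum>k<n. (\<Delta> (Suc k) - \<Delta> k) * real (min m (D - k)))
      = (\<Sum>l<m. \<Sum>k<n. (\<Delta> (Suc k) - \<Delta> k) * (if k < D - l then 1 else 0))"
    unfolding min_eq sum_distrib_left by (rule sum.swap)
  also have "\<dots> = (\<Sum>l<m. \<Delta> (D - l))"
  proof (rule sum.cong[OF refl])
    fix l
    have "(\<Sum>k<n. (\<Delta> (Suc k) - \<Delta> k) * (if k < D - l then 1 else 0))
        = (\<Sum>k<D - l. \<Delta> (Suc k) - \<Delta> k)"
      using assms by (intro sum.mono_neutral_cong_right) auto
    then show "(\<Sum>k<n. (\<Delta> (Suc k) - \<Delta> k) * (if k < D - l then 1 else 0)) = \<Delta> (D - l)"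
      using assms by (simp add: sum_lessThan_telescope)
  qed
  finally show ?thesis .
qed

text \<open>Upper bound for the rate of change of \<open>X k\<close>, \<open>k < n\<close>, when the algorithm has \<open>n\<close> and the competitor
  \<open>no\<close> unfinished jobs; note the truncated subtraction \<open>n - no\<close>.\<close>

definition level_drift :: "nat \<Rightarrow> nat \<Rightarrow> nat \<Rightarrow> real \<Rightarrow> nat \<Rightarrow> real" where
  "level_drift m n no S k =
     (if k < n - no then S - srpt_speed m n * real (min m (n - no - k)) else max 0 (S - srpt_speed m n))"

text \<open>The inequality at one instant that makes the potential argument work: \<open>S\<close>
  stands for the total speed of the competitor, and \<open>m * P (S / m)\<close> is the least power
  that can produce it. The last term is the total speed of the algorithm over
  \<open>P\<inverse>(1)\<close>, so over time it adds up to a multiple of the work done.\<close>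

definition amortizes :: "nat \<Rightarrow> (nat \<Rightarrow> real) \<Rightarrow> bool" where
  "amortizes m \<Delta> \<longleftrightarrow> \<Delta> 0 = 0 \<and> mono \<Delta> \<and>
     (\<forall>n no S. 0 \<le> S \<longrightarrow>
        real n + (\<Sum>k<n. (\<Delta> (Suc k) - \<Delta> k) * level_drift m n no S k)
          \<le> P (2 - 1 / real m) * (real no + real m * P (S / real m)
              + real (min m n) * srpt_speed m n / Pinv P 1))"

lemma srpt_speed_nonneg: "0 \<le> srpt_speed m n"
  by (auto simp: srpt_speed_def intro!: Pinv_nonneg)

text \<open>For one server the factor \<open>A\<close> may be 1, so \<open>\<Delta>\<close> must be a subgradient of \<open>P\<close>. For \<open>m \<ge> 2\<close> subgradients
  may vary too fast within the window \<open>{D - m<..D}\<close> of levels on which the algorithm makes progress;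
  the chord slopes \<open>P x / x\<close> vary slowly enough, and the loss is covered by \<open>A\<close>.\<close>

lemma amortizes_single_server: "\<exists>\<Delta>. amortizes 1 \<Delta>"
proof -
  have "\<forall>i::nat. \<exists>g\<ge>0. \<forall>z\<ge>0. real i + g * (z - Pinv P (real i)) \<le> P z"
    using subgradient_exists[OF Pinv_nonneg] P_Pinv by (metis of_nat_0_le_iff)
  then obtain g where g0: "\<And>i::nat. 0 \<le> g i"
    and g: "\<And>(i::nat) z. z \<ge> 0 \<Longrightarrow> real i + g i * (z - Pinv P (real i)) \<le> P z"
    by metis
  \<comment> \<open>A slope chosen at 0 may be positive, so the value at 0 is reset.\<close>
  define \<Delta> where "\<Delta> i = (if i = 0 then 0 else g i)" for i
  have \<Delta>0: "\<Delta> 0 = 0" by (simp add: \<Delta>_def)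
  have mono: "mono \<Delta>"
  proof (rule monoI)
    fix i j :: nat assume "i \<le> j"
    show "\<Delta> i \<le> \<Delta> j"
    proof (cases "i = 0 \<or> i = j")
      case True
      then show ?thesis using g0 by (auto simp: \<Delta>_def)
    next
      case False
      with \<open>i \<le> j\<close> have ij: "0 < i" "i < j" by auto
      let ?x = "Pinv P (real i)" and ?y = "Pinv P (real j)"
      have xy: "?x < ?y"
        using Pinv_mono[of "real i" "real j"] P_Pinv[of "real i"] P_Pinv[of "real j"] ij
        by (cases "?x = ?y") auto
      \<comment> \<open>Each of the two tangents is evaluated at the other point and the
        inequalities are added: slopes of a convex function increase.\<close>
      have "g i * (?y - ?x) \<le> g j * (?y - ?x)"
        using g[of ?y i] g[of ?x j] P_Pinv Pinv_nonneg by (simp add: algebra_simps)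
      with xy ij show ?thesis by (simp add: \<Delta>_def)
    qed
  qed
  have "real n + (\<Sum>k<n. (\<Delta> (Suc k) - \<Delta> k) * level_drift 1 n no S k)
      \<le> P (2 - 1 / real 1) * (real no + real 1 * P (S / real 1)
              + real (min 1 n) * srpt_speed 1 n / Pinv P 1)"
    if S: "0 \<le> S" for n no and S :: real
  proof -
    define s where "s = srpt_speed 1 n"
    have s0: "0 \<le> s" by (simp add: s_def srpt_speed_nonneg)
    have PS: "0 \<le> P S" using P_nonneg S by simp
    have main: "real n + (\<Sum>k<n. (\<Delta> (Suc k) - \<Delta> k) * level_drift 1 n no S k) \<le> real no + P S"
    proof (cases "n = 0")
      case True
      then show ?thesis using PS by simp
    next
      case n: False
      have s: "s = Pinv P (real n)" using n by (simp add: s_def srpt_speed_def)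
      show ?thesis
      proof (cases "S \<ge> s")
        case True
        have "level_drift 1 n no S k = S - s" for k
          using True by (auto simp: level_drift_def s_def)
        then have "(\<Sum>k<n. (\<Delta> (Suc k) - \<Delta> k) * level_drift 1 n no S k) = \<Delta> n * (S - s)"
          by (simp add: sum_distrib_right[symmetric] sum_lessThan_telescope \<Delta>0)
        with g[OF S, of n] s n show ?thesis by (simp add: \<Delta>_def)
      next
        case False
        \<comment> \<open>When the competitor is slower, the levels from \<open>n - no\<close> on
          have drift 0, so the telescoped weight is \<open>\<Delta> (n - no)\<close> and the tangent
          at \<open>n - no\<close> jobs applies. Its point of contact is at most \<open>s\<close>,
          which only helps since \<open>\<Delta>\<close> is nonnegative.\<close>
        have "(\<Sum>k<n. (\<Delta> (Suc k) - \<Delta> k) * level_drift 1 n no S k)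
            = (\<Sum>k<n - no. (\<Delta> (Suc k) - \<Delta> k) * (S - s))"
          using False by (intro sum.mono_neutral_cong_right) (auto simp: level_drift_def s_def)
        also have "\<dots> = \<Delta> (n - no) * (S - s)"
          by (simp add: sum_distrib_right[symmetric] sum_lessThan_telescope \<Delta>0)
        also have "real n + \<dots> \<le> real no + P S"
        proof (cases "n - no = 0")
          case True
          then show ?thesis using PS by (simp add: \<Delta>_def)
        next
          case D: False
          have "\<Delta> (n - no) * (S - s) \<le> \<Delta> (n - no) * (S - Pinv P (real (n - no)))"
            using g0 D s Pinv_mono[of "real (n - no)" "real n"] by (intro mult_left_mono) (auto simp: \<Delta>_def)
          then show ?thesis using g[OF S, of "n - no"] D by (simp add: \<Delta>_def)
        qed
        finally show ?thesis by simp
      qed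
    qed
    also have "\<dots> \<le> P 1 * (real no + P S + real (min 1 n) * s / Pinv P 1)"
    proof -
      have "1 * (real no + P S) \<le> P 1 * (real no + P S + real (min 1 n) * s / Pinv P 1)"
        using P_one_ge PS s0 Pinv_nonneg[of 1] by (intro mult_mono) auto
      then show ?thesis by simp
    qed
    finally show ?thesis by (simp add: s_def)
  qed
  with mono have "amortizes 1 \<Delta>" unfolding amortizes_def by (auto simp: \<Delta>_def)
  then show ?thesis by blast
qed

lemma amortizes_multi_server:
  assumes m: "2 \<le> m"
  shows "\<exists>\<Delta>. amortizes m \<Delta>"
proof -
  define A where "A = P (2 - 1 / real m)"
  \<comment> \<open>This is where \<open>m \<ge> 2\<close> enters: then
    \<open>2 - 1/m \<ge> 3/2\<close>, as \<open>chord_bound\<close> requires.\<close>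
  have A32: "P (3/2) \<le> A" unfolding A_def using m by (intro P_mono) (auto simp: field_simps)
  have A1: "1 \<le> A" using A32 P_ge[of "3/2"] by simp
  \<comment> \<open>With \<open>x = Pinv P (i / m)\<close> this is \<open>A * (P x / x)\<close>, the
    scaled slope of the chord from the origin; at \<open>i = 0\<close> the zero numerator gives
    0.\<close>
  define \<Delta> where "\<Delta> i = A * (real i / real m / Pinv P (real i / real m))" for i
  have \<Delta>0: "\<Delta> 0 = 0" by (simp add: \<Delta>_def)
  have mono: "mono \<Delta>"
  proof (rule monoI)
    fix i j :: nat assume ij: "i \<le> j"
    show "\<Delta> i \<le> \<Delta> j"
    proof (cases "i = 0")
      case True
      then show ?thesis using A1 Pinv_nonneg by (auto simp: \<Delta>_def)
    next
      case False
      let ?x = "Pinv P (real i / real m)" and ?y = "Pinv P (real j / real m)"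
      have x: "0 < ?x" "?x \<le> ?y" using False ij m by (auto intro!: Pinv_pos Pinv_mono simp: divide_right_mono)
      have "P ((?x / ?y) * ?y) \<le> (?x / ?y) * P ?y" using x by (intro P_scale_le) auto
      then have "real i / real m \<le> (?x / ?y) * (real j / real m)" using x P_Pinv by simp
      then have "real i / real m / ?x \<le> real j / real m / ?y"
        using x m by (simp add: field_simps)
      then show ?thesis using A1 unfolding \<Delta>_def by (intro mult_left_mono) auto
    qed
  qed
  have "real n + (\<Sum>k<n. (\<Delta> (Suc k) - \<Delta> k) * level_drift m n no S k)
      \<le> A * (real no + real m * P (S / real m) + real (min m n) * srpt_speed m n / Pinv P 1)"
    if S: "0 \<le> S" for n no S
  proof (cases "n = 0")
    case True
    then show ?thesis using A1 S P_nonneg[of "S / real m"] by simp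
  next
    case n: False
    define s where "s = srpt_speed m n"
    define D where "D = n - no"
    define y where "y = real n / real m"
    have y: "0 < y" using n m by (simp add: y_def)
    have s0: "0 \<le> s" by (simp add: s_def srpt_speed_nonneg)
    have s1: "0 < Pinv P 1" by (rule Pinv_pos) simp
    have PS: "0 \<le> P (S / real m)" using P_nonneg S by simp
    \<comment> \<open>For \<open>k \<ge> D\<close> the minimum is 0 by truncated subtraction, and
      \<open>max 0 (S - s) \<le> S\<close>. This gives all levels one formula, to which
      \<open>sum_increments_min\<close> applies.\<close>
    have "(\<Sum>k<n. (\<Delta> (Suc k) - \<Delta> k) * level_drift m n no S k)
        \<le> (\<Sum>k<n. (\<Delta> (Suc k) - \<Delta> k) * (S - s * real (min m (D - k))))"
      using S s0 monoD[OF mono] by (intro sum_mono mult_left_mono) (auto simp: level_drift_def s_def D_def)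
    also have "\<dots> = S * \<Delta> n - s * (\<Sum>l<m. \<Delta> (D - l))"
    proof -
      have "(\<Sum>k<n. (\<Delta> (Suc k) - \<Delta> k) * (S - s * real (min m (D - k))))
        = (\<Sum>k<n. S * (\<Delta> (Suc k) - \<Delta> k)) - (\<Sum>k<n. s * ((\<Delta> (Suc k) - \<Delta> k) * real (min m (D - k))))"
        by (subst sum_subtractf[symmetric], rule sum.cong) (auto simp: algebra_simps)
      then show ?thesis using sum_increments_min[of \<Delta> D n m, OF \<Delta>0]
        by (simp add: sum_distrib_left[symmetric] sum_lessThan_telescope \<Delta>0 D_def)
    qed
    finally have drift: "(\<Sum>k<n. (\<Delta> (Suc k) - \<Delta> k) * level_drift m n no S k)
        \<le> S * \<Delta> n - s * (\<Sum>l<m. \<Delta> (D - l))" .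
    have "S * \<Delta> n = real m * (A * (S / real m * (P (Pinv P y) / Pinv P y)))"
      using m y P_Pinv[of y] by (simp add: \<Delta>_def y_def)
    also have "\<dots> \<le> real m * (A * P (S / real m) + (A - 1) * P (Pinv P y))"
      using S y by (intro mult_left_mono chord_bound Pinv_pos A32) auto
    also have "\<dots> = A * (real m * P (S / real m)) + (A - 1) * (real m * y)"
      using P_Pinv[of y] y by (simp add: algebra_simps)
    also have "real m * y = real n" using m by (simp add: y_def)
    finally have opt: "S * \<Delta> n \<le> A * (real m * P (S / real m)) + (A - 1) * real n" .
    \<comment> \<open>By \<open>drift\<close> and \<open>opt\<close> it remains to bound
      \<open>n + (A - 1) * n = A * n\<close> by the sum of \<open>A * no\<close>, the algorithm's
      progress \<open>s * (\<Sum>l<m. \<Delta> (D - l))\<close> and the speed term.\<close>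
    show ?thesis
    proof (cases "n \<ge> m")
      case True
      have s: "s = Pinv P y" using True by (simp add: s_def srpt_speed_def y_def)
      have "Pinv P 1 \<le> s" unfolding s using True m by (intro Pinv_mono) (auto simp: y_def)
      then have ms: "real m \<le> real m * s / Pinv P 1" using s1 m by (simp add: field_simps)
      \<comment> \<open>\<open>\<Delta> (D - l)\<close> divides by a speed \<open>?z\<close> that is
        at most \<open>s\<close>. The left side subtracts in the reals, hence is nonpositive when
        the truncated \<open>D - l\<close> is 0.\<close>
      have credit: "A * ((real D - real l) / real m) \<le> s * \<Delta> (D - l)" for l
      proof (cases "D - l = 0")
        case True
        then show ?thesis using A1 \<Delta>0 m by (simp add: mult_nonneg_nonpos divide_nonpos_nonneg)
      next
        case False
        let ?z = "Pinv P (real (D - l) / real m)"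
        have z: "0 < ?z" using False m by (intro Pinv_pos) auto
        have zs: "?z \<le> s" unfolding s y_def using m by (intro Pinv_mono divide_right_mono) (auto simp: D_def)
        have "A * (real (D - l) / real m) * 1 \<le> A * (real (D - l) / real m) * (s / ?z)"
          using z zs A1 by (intro mult_left_mono) auto
        then show ?thesis using False by (simp add: \<Delta>_def of_nat_diff algebra_simps)
      qed
      \<comment> \<open>Replacing every \<open>l < m\<close> by \<open>m\<close> loses at most
        \<open>A * m\<close>, and \<open>ms\<close> lets the speed term repay this.\<close>
      have "A * real D - A * real m \<le> (\<Sum>l<m. A * ((real D - real l) / real m))"
      proof -
        have "(\<Sum>l<m. A * ((real D - real m) / real m)) \<le> (\<Sum>l<m. A * ((real D - real l) / real m))"
          using A1 m by (intro sum_mono mult_left_mono divide_right_mono) auto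
        then show ?thesis using m by (simp add: algebra_simps diff_divide_distrib)
      qed
      also have "\<dots> \<le> s * (\<Sum>l<m. \<Delta> (D - l))"
        unfolding sum_distrib_left by (intro sum_mono credit)
      finally have cr: "A * real D - A * real m \<le> s * (\<Sum>l<m. \<Delta> (D - l))" .
      have "A * real n \<le> A * (real D + real no)" using A1 by (intro mult_left_mono) (auto simp: D_def)
      moreover have "A * real m \<le> A * (real m * s / Pinv P 1)" using ms A1 by (intro mult_left_mono) auto
      ultimately show ?thesis using drift opt cr True
        unfolding s_def[symmetric] by (simp add: algebra_simps)
    next
      case False
      \<comment> \<open>With fewer jobs than servers the speed term alone equals \<open>n\<close>,
        so the progress only has to be nonnegative.\<close>
      have s: "s = Pinv P 1" using False by (simp add: s_def srpt_speed_def)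
      have "0 \<le> s * (\<Sum>l<m. \<Delta> (D - l))"
        using s0 monoD[OF mono, of 0] \<Delta>0 by (intro mult_nonneg_nonneg sum_nonneg) auto
      moreover have "real (min m n) * s / Pinv P 1 = real n" using s s1 False by simp
      moreover have "0 \<le> A * real no" using A1 by simp
      ultimately show ?thesis using drift opt unfolding s_def[symmetric] by (simp add: algebra_simps)
    qed
  qed
  with mono \<Delta>0 have "amortizes m \<Delta>" unfolding amortizes_def A_def by auto
  then show ?thesis by blast
qed

lemma amortizes_exists: "1 \<le> m \<Longrightarrow> \<exists>\<Delta>. amortizes m \<Delta>"
  using amortizes_single_server amortizes_multi_server[of m] by (cases "m = 1") auto

end

section \<open>Work outside the largest jobs\<close>

text \<open>A minimum over all removals of at most \<open>i\<close> jobs avoids choosing an order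
  among ties, makes any removal an upper bound, and is meaningful for every \<open>i\<close>. For
  nonnegative sizes the minimum is attained by removing largest jobs, see
  \<open>bottom_work_eq_largest\<close>.\<close>

definition bottom_work :: "'j set \<Rightarrow> ('j \<Rightarrow> real) \<Rightarrow> nat \<Rightarrow> real" where
  "bottom_work F r i = Min ((\<lambda>R. sum r (F - R)) ` {R. R \<subseteq> F \<and> card R \<le> i})"

lemma bottom_work_le:
  "finite F \<Longrightarrow> R \<subseteq> F \<Longrightarrow> card R \<le> i \<Longrightarrow> bottom_work F r i \<le> sum r (F - R)"
  unfolding bottom_work_def by (rule Min_le) auto

lemma bottom_work_attained:
  assumes "finite F"
  obtains R where "R \<subseteq> F" "card R \<le> i" "bottom_work F r i = sum r (F - R)"
proof -
  have "{} \<in> {R. R \<subseteq> F \<and> card R \<le> i}" by simp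
  then have "(\<lambda>R. sum r (F - R)) ` {R. R \<subseteq> F \<and> card R \<le> i} \<noteq> {}" by blast
  then have "bottom_work F r i \<in> (\<lambda>R. sum r (F - R)) ` {R. R \<subseteq> F \<and> card R \<le> i}"
    unfolding bottom_work_def using assms by (intro Min_in) auto
  then show ?thesis using that by blast
qed

lemma bottom_work_nonneg:
  assumes "finite F" "\<And>j. j \<in> F \<Longrightarrow> 0 \<le> r j"
  shows "0 \<le> bottom_work F r i"
  by (rule bottom_work_attained[OF assms(1), of i r]) (auto intro!: sum_nonneg assms(2))

lemma bottom_work_antimono:
  assumes "finite F" "i \<le> i'"
  shows "bottom_work F r i' \<le> bottom_work F r i"
  using bottom_work_attained[OF assms(1), of i r] bottom_work_le[OF assms(1), of _ i' r] assms(2)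
  by (metis le_trans)

lemma bottom_work_eq_0:
  assumes "finite F" "\<And>j. j \<in> F \<Longrightarrow> 0 \<le> r j" "card {j \<in> F. 0 < r j} \<le> i"
  shows "bottom_work F r i = 0"
proof -
  have "bottom_work F r i \<le> sum r (F - {j \<in> F. 0 < r j})"
    using assms by (intro bottom_work_le) auto
  also have "\<dots> = 0" using assms(2) by (intro sum.neutral) (fastforce simp: order.order_iff_strict)
  finally show ?thesis using bottom_work_nonneg[of F r i] assms by simp
qed

text \<open>The removal that is best for \<open>q\<close> is also admissible for \<open>p\<close>,
  so it does not matter which jobs lose the volume \<open>V\<close>. This is why the competitor's
  service order is irrelevant.\<close>

lemma bottom_work_drop_le:
  assumes F: "finite F" and le: "\<And>j. j \<in> F \<Longrightarrow> q j \<le> p j" and V: "(\<Sum>j\<in>F. p j - q j) \<le> V"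
  shows "bottom_work F p i - V \<le> bottom_work F q i"
proof -
  obtain R where R: "R \<subseteq> F" "card R \<le> i" "bottom_work F q i = sum q (F - R)"
    using bottom_work_attained[OF F] by blast
  have "(\<Sum>j\<in>F - R. p j - q j) \<le> (\<Sum>j\<in>F. p j - q j)"
    using F le by (intro sum_mono2) auto
  with V have "sum p (F - R) - V \<le> sum q (F - R)" by (simp add: sum_subtractf)
  then show ?thesis using bottom_work_le[OF F R(1,2), of p] R(3) by linarith
qed

lemma exists_largest_subset:
  fixes r :: "'j \<Rightarrow> real"
  assumes "finite F" "i \<le> card F"
  shows "\<exists>R\<subseteq>F. card R = i \<and> (\<forall>j\<in>F - R. \<forall>j'\<in>R. r j \<le> r j')"
  using assms(2)
proof (induction i)
  case 0
  then show ?case by (intro exI[of _ "{}"]) auto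
next
  case (Suc i)
  then obtain R where R: "R \<subseteq> F" "card R = i" "\<forall>j\<in>F - R. \<forall>j'\<in>R. r j \<le> r j'" by auto
  have fR: "finite R" using R assms finite_subset by blast
  have ne: "F - R \<noteq> {}" 
  proof
    assume "F - R = {}"
    with R(1) have "R = F" by auto
    with R(2) Suc.prems show False by simp
  qed
  have "Max (r ` (F - R)) \<in> r ` (F - R)" using ne assms(1) by (intro Max_in) auto
  then obtain x where x: "x \<in> F - R" "r x = Max (r ` (F - R))" by auto
  have "\<forall>j\<in>F - R. r j \<le> r x" unfolding x(2) using assms(1) by (auto intro: Max_ge)
  then show ?case
    using R x(1) fR by (intro exI[of _ "insert x R"]) auto
qed

text \<open>Exchange argument: compare \<open>R\<close> with another removal \<open>R'\<close>. The
  set \<open>R' - R\<close> has at most as many elements as \<open>R - R'\<close>, and the smallest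
  size \<open>c\<close> in \<open>R - R'\<close> separates the sizes in the two sets.\<close>

lemma bottom_work_eq_largest:
  assumes F: "finite F" and nn: "\<And>j. j \<in> F \<Longrightarrow> 0 \<le> r j" and R: "R \<subseteq> F"
    and top: "\<And>j j'. j \<in> F - R \<Longrightarrow> j' \<in> R \<Longrightarrow> r j \<le> r j'"
  shows "bottom_work F r (card R) = sum r (F - R)"
proof (rule antisym)
  show "bottom_work F r (card R) \<le> sum r (F - R)" using F R by (intro bottom_work_le) auto
  obtain R' where R': "R' \<subseteq> F" "card R' \<le> card R" "bottom_work F r (card R) = sum r (F - R')"
    using bottom_work_attained[OF F] by blast
  have fin: "finite R" "finite R'" using R R' F finite_subset by auto
  have card_le: "card (R' - R) \<le> card (R - R')"
    using R'(2) fin by (simp add: card_Diff_subset_Int Int_commute)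
  have "sum r (R' - R) \<le> sum r (R - R')"
  proof (cases "R - R' = {}")
    case True
    with card_le fin have "R' - R = {}" by simp
    with True show ?thesis by simp
  next
    case False
    define c where "c = Min (r ` (R - R'))"
    have cin: "c \<in> r ` (R - R')" unfolding c_def using False fin by (intro Min_in) auto
    then have c0: "0 \<le> c" using nn R by auto
    have "sum r (R' - R) \<le> of_nat (card (R' - R)) * c"
      using cin top R' by (intro sum_bounded_above) auto
    also have "\<dots> \<le> of_nat (card (R - R')) * c" using card_le c0 by (intro mult_right_mono) auto
    also have "\<dots> \<le> sum r (R - R')"
      using fin by (intro sum_bounded_below) (auto simp: c_def)
    finally show ?thesis .
  qed
  moreover have "sum r (F - R) = sum r (F - (R \<union> R')) + sum r (R' - R)"
  proof -
    have "F - R = (F - (R \<union> R')) \<union> (R' - R)" using R'(1) by auto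
    also have "sum r \<dots> = sum r (F - (R \<union> R')) + sum r (R' - R)"
      using F fin by (intro sum.union_disjoint) auto
    finally show ?thesis .
  qed
  moreover have "sum r (F - R') = sum r (F - (R \<union> R')) + sum r (R - R')"
  proof -
    have "F - R' = (F - (R \<union> R')) \<union> (R - R')" using R by auto
    also have "sum r \<dots> = sum r (F - (R \<union> R')) + sum r (R - R')"
      using F fin by (intro sum.union_disjoint) auto
    finally show ?thesis .
  qed
  ultimately show "sum r (F - R) \<le> bottom_work F r (card R)" using R'(3) by linarith
qed

section \<open>Excess of one family of job sizes over another\<close>

definition excess :: "'j set \<Rightarrow> ('j \<Rightarrow> real) \<Rightarrow> ('j \<Rightarrow> real) \<Rightarrow> nat \<Rightarrow> real" where
  "excess F r p k = Max (insert 0 ((\<lambda>i. bottom_work F r (i + k) - bottom_work F p i) ` {..card F}))"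

text \<open>The definition lets \<open>i\<close> range over \<open>{..card F}\<close> to have a
  finite maximum. Beyond that the first bottom work is 0 and the second is nonnegative, so the
  inserted 0 already covers these levels.\<close>

lemma excess_le_iff:
  assumes F: "finite F" and r: "\<And>j. j \<in> F \<Longrightarrow> 0 \<le> r j" and p: "\<And>j. j \<in> F \<Longrightarrow> 0 \<le> p j"
  shows "excess F r p k \<le> x \<longleftrightarrow> 0 \<le> x \<and> (\<forall>i. bottom_work F r (i + k) \<le> bottom_work F p i + x)"
proof -
  have big: "bottom_work F r (i + k) \<le> bottom_work F p i + x" if "card F < i" "0 \<le> x" for i
  proof -
    have "card {j \<in> F. 0 < r j} \<le> card F" using F by (intro card_mono) auto
    then have "bottom_work F r (i + k) = 0" using that F r by (intro bottom_work_eq_0) auto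
    then show ?thesis using bottom_work_nonneg[of F p i] F p that by simp
  qed
  have "excess F r p k \<le> x \<longleftrightarrow> 0 \<le> x \<and> (\<forall>i\<le>card F. bottom_work F r (i + k) - bottom_work F p i \<le> x)"
    unfolding excess_def by (subst Max_le_iff) auto
  also have "\<dots> \<longleftrightarrow> 0 \<le> x \<and> (\<forall>i. bottom_work F r (i + k) \<le> bottom_work F p i + x)"
    using big by (smt (verit) not_le)
  finally show ?thesis .
qed

text \<open>Start from the best removal \<open>R\<close> for \<open>p\<close>. If it keeps the new
  job, both sides grow by the same size. If it removes the new job, the old inequality at level
  \<open>i - 1\<close> is used and the new job is added to the removal for \<open>r\<close> as
  well.\<close>

lemma excess_insert_le:
  assumes F: "finite F" and r: "\<And>j. j \<in> insert a F \<Longrightarrow> 0 \<le> r j"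
    and p: "\<And>j. j \<in> insert a F \<Longrightarrow> 0 \<le> p j" and a: "a \<notin> F" "r a = p a"
  shows "excess (insert a F) r p k \<le> excess F r p k"
proof -
  define x where "x = excess F r p k"
  have x: "0 \<le> x" "\<And>i. bottom_work F r (i + k) \<le> bottom_work F p i + x"
    using excess_le_iff[of F r p k x] F r p by (auto simp: x_def)
  have "bottom_work (insert a F) r (i + k) \<le> bottom_work (insert a F) p i + x" for i
  proof -
    obtain R where R: "R \<subseteq> insert a F" "card R \<le> i" "bottom_work (insert a F) p i = sum p (insert a F - R)"
      using bottom_work_attained[of "insert a F"] F by blast
    show ?thesis
    proof (cases "a \<in> R")
      case False
      obtain R' where R': "R' \<subseteq> F" "card R' \<le> i + k" "bottom_work F r (i + k) = sum r (F - R')"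
        using bottom_work_attained[OF F] by blast
      have "bottom_work (insert a F) r (i + k) \<le> sum r (insert a F - R')"
        using R' F by (intro bottom_work_le) auto
      also have "\<dots> = r a + bottom_work F r (i + k)"
        using R' F a(1) by (subst insert_Diff_if) auto
      also have "\<dots> \<le> p a + bottom_work F p i + x" using x(2)[of i] a by simp
      also have "\<dots> \<le> p a + sum p (F - R) + x"
        using bottom_work_le[of F R i p] R F False by auto
      also have "p a + sum p (F - R) = sum p (insert a F - R)"
        using F a(1) False by (subst insert_Diff_if) auto
      finally show ?thesis using R(3) by simp
    next
      case True
      have fR: "finite R" using R(1) F finite_subset by blast
      have i: "card (R - {a}) \<le> i - 1" "1 \<le> i"
        using True R(2) fR card_gt_0_iff[of R] by (auto simp: card_Diff_singleton)
      obtain R' where R': "R' \<subseteq> F" "card R' \<le> i - 1 + k" "bottom_work F r (i - 1 + k) = sum r (F - R')"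
        using bottom_work_attained[OF F] by blast
      have fR': "finite R'" using R'(1) F finite_subset by blast
      have "card (insert a R') \<le> i + k" using R' i fR' a by (subst card_insert_disjoint) auto
      then have "bottom_work (insert a F) r (i + k) \<le> sum r (insert a F - insert a R')"
        using R' F by (intro bottom_work_le) auto
      also have "insert a F - insert a R' = F - R'" using a by auto
      also have "sum r (F - R') \<le> bottom_work F p (i - 1) + x" using x(2)[of "i - 1"] R'(3) by simp
      also have "bottom_work F p (i - 1) \<le> sum p (F - (R - {a}))"
        using R F i by (intro bottom_work_le) auto
      also have "F - (R - {a}) = insert a F - R" using True a by auto
      finally show ?thesis using R(3) by simp
    qed
  qed
  then show ?thesis
    unfolding x_def[symmetric] using x(1) F r p by (subst excess_le_iff) auto
qed

lemma excess_union_le: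
  assumes "finite G" and "finite F" and "F \<inter> G = {}" and "\<And>j. j \<in> F \<union> G \<Longrightarrow> 0 \<le> r j"
    and "\<And>j. j \<in> F \<union> G \<Longrightarrow> 0 \<le> p j" and "\<And>j. j \<in> G \<Longrightarrow> r j = p j"
  shows "excess (F \<union> G) r p k \<le> excess F r p k"
  using assms
proof (induction G rule: finite_induct)
  case empty
  then show ?case by simp
next
  case (insert a G)
  have "excess (insert a (F \<union> G)) r p k \<le> excess (F \<union> G) r p k"
    using insert by (intro excess_insert_le) auto
  with insert show ?case by fastforce
qed

text \<open>For \<open>k < n - no\<close> the decisive level is \<open>i = no\<close>: lower levels
  leave at least as many jobs to work on, and from \<open>no\<close> on the side of
  \<open>p'\<close> is 0 while that of \<open>r'\<close> only decreases. For
  \<open>n - no \<le> k < n\<close> a level with \<open>i + k < n\<close> still has progress at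
  least \<open>c\<close>, and all other levels of \<open>r'\<close> are 0. For
  \<open>k \<ge> n\<close> everything on the side of \<open>r'\<close> is 0.\<close>

lemma excess_step:
  assumes F: "finite F"
    and nn: "\<And>j. j \<in> F \<Longrightarrow> 0 \<le> r j" "\<And>j. j \<in> F \<Longrightarrow> 0 \<le> p j"
      "\<And>j. j \<in> F \<Longrightarrow> 0 \<le> r' j" "\<And>j. j \<in> F \<Longrightarrow> 0 \<le> p' j"
    and m: "1 \<le> m" and c: "0 \<le> c"
    and alg: "\<And>i. bottom_work F r' i \<le> bottom_work F r i - c * real (min m (n - i))"
    and opt: "\<And>i. bottom_work F p i - V \<le> bottom_work F p' i"
    and r'_zero: "\<And>i. n \<le> i \<Longrightarrow> bottom_work F r' i = 0"
    and p'_zero: "\<And>i. no \<le> i \<Longrightarrow> bottom_work F p' i = 0"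
  shows "excess F r' p' k \<le> excess F r p k
     + (if k < n - no then V - c * real (min m (n - no - k)) else if k < n then max 0 (V - c) else 0)"
proof -
  define x where "x = excess F r p k"
  have x: "0 \<le> x" "\<And>i. bottom_work F r (i + k) \<le> bottom_work F p i + x"
    using excess_le_iff[of F r p k x] F nn by (auto simp: x_def)
  have nonneg: "0 \<le> bottom_work F r' i" "0 \<le> bottom_work F p' i" for i
    using bottom_work_nonneg F nn by blast+
  have step: "bottom_work F r' (i + k) \<le> bottom_work F p' i + (x + V - c * real (min m (n - (i + k))))" for i
    using alg[of "i + k"] opt[of i] x(2)[of i] by linarith
  consider "k < n - no" | "n - no \<le> k" "k < n" | "n \<le> k" by linarith
  then show ?thesis
  proof cases
    case 1
    let ?d = "V - c * real (min m (n - no - k))"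
    have low: "bottom_work F r' (i + k) \<le> bottom_work F p' i + (x + ?d)" if "i \<le> no" for i
    proof -
      have "c * real (min m (n - no - k)) \<le> c * real (min m (n - (i + k)))"
        using that c by (intro mult_left_mono) auto
      then show ?thesis using step[of i] by linarith
    qed
    have high: "bottom_work F r' (i + k) \<le> bottom_work F p' i + (x + ?d)" if "no \<le> i" for i
      using low[of no] p'_zero[of no] p'_zero[OF that]
        bottom_work_antimono[OF F, of "no + k" "i + k" r'] that by simp
    \<comment> \<open>Level \<open>no\<close> gives a nonnegative left side against 0 plus
      \<open>x + ?d\<close>, so the clamp of \<open>excess\<close> at 0 does no harm even if
      \<open>?d\<close> is negative.\<close>
    have "0 \<le> x + ?d" using low[of no] p'_zero[of no] nonneg(1)[of "no + k"] by simp
    moreover have "bottom_work F r' (i + k) \<le> bottom_work F p' i + (x + ?d)" for i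
      using low[of i] high[of i] by linarith
    ultimately have "excess F r' p' k \<le> x + ?d" using F nn by (simp add: excess_le_iff)
    then show ?thesis using 1 unfolding x_def by simp
  next
    case 2
    have "bottom_work F r' (i + k) \<le> bottom_work F p' i + (x + max 0 (V - c))" for i
    proof (cases "i + k < n")
      case True
      define y where "y = real (min m (n - (i + k)))"
      have "c * 1 \<le> c * y" unfolding y_def using c m True by (intro mult_left_mono) auto
      then show ?thesis using step[of i, folded y_def] max.cobounded2[of "V - c" 0] by linarith
    next
      case False
      then show ?thesis using r'_zero[of "i + k"] nonneg(2)[of i] x(1) by simp
    qed
    then have "excess F r' p' k \<le> x + max 0 (V - c)" using F nn x(1) by (simp add: excess_le_iff)
    then show ?thesis using 2 unfolding x_def by simp
  next
    case 3
    have "bottom_work F r' (i + k) \<le> bottom_work F p' i + x" for i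
      using r'_zero[of "i + k"] nonneg(2)[of i] x(1) 3 by simp
    then have "excess F r' p' k \<le> x" using F nn x(1) by (simp add: excess_le_iff)
    then show ?thesis using 3 unfolding x_def by auto
  qed
qed

section \<open>Schedules as fluid processes\<close>

lemma nn_integral_Icc_eq_integral:
  fixes f :: "real \<Rightarrow> real"
  assumes f: "f \<in> borel_measurable borel" and nn: "\<And>x. 0 \<le> f x"
    and fin: "(\<integral>\<^sup>+x\<in>{u..v}. ennreal (f x) \<partial>lborel) < \<infinity>"
  shows "f integrable_on {u..v}"
    and "(\<integral>\<^sup>+x\<in>{u..v}. ennreal (f x) \<partial>lborel) = ennreal (integral {u..v} f)"
proof -
  have eq: "(\<integral>\<^sup>+x\<in>{u..v}. ennreal (f x) \<partial>lborel) = (\<integral>\<^sup>+x. ennreal (indicator {u..v} x *\<^sub>R f x) \<partial>lborel)"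
    by (intro nn_integral_cong) (auto split: split_indicator)
  have int: "set_integrable lborel {u..v} f"
    unfolding set_integrable_def using f nn fin
    by (intro integrableI_nonneg) (auto simp: eq)
  show "f integrable_on {u..v}" using set_borel_integral_eq_integral(1)[OF int] .
  have "(\<integral>\<^sup>+x. ennreal (indicator {u..v} x *\<^sub>R f x) \<partial>lborel) = ennreal (integral\<^sup>L lborel (\<lambda>x. indicator {u..v} x *\<^sub>R f x))"
    using int nn by (intro nn_integral_eq_integral) (auto simp: set_integrable_def)
  then show "(\<integral>\<^sup>+x\<in>{u..v}. ennreal (f x) \<partial>lborel) = ennreal (integral {u..v} f)"
    using set_borel_integral_eq_integral(2)[OF int] by (simp add: eq set_lebesgue_integral_def)
qed

text \<open>The measures with densities \<open>f\<close> and \<open>g\<close> agree on rays, which generate the Borel sets. This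
  rules out schedules that alternate infinitely fast between two jobs with equal remaining sizes.\<close>

lemma AE_eq_of_indefinite_integrals_eq:
  fixes f g :: "real \<Rightarrow> real"
  assumes f: "f \<in> borel_measurable borel" "\<And>x. 0 \<le> f x" "(\<integral>\<^sup>+x\<in>{u..v}. ennreal (f x) \<partial>lborel) < \<infinity>"
    and g: "g \<in> borel_measurable borel" "\<And>x. 0 \<le> g x" "(\<integral>\<^sup>+x\<in>{u..v}. ennreal (g x) \<partial>lborel) < \<infinity>"
    and eq: "\<And>t. u \<le> t \<Longrightarrow> t \<le> v \<Longrightarrow> integral {u..t} f = integral {u..t} g"
  shows "AE t in lborel. t \<in> {u..v} \<longrightarrow> f t = g t"
proof -
  have ray: "emeasure (density lborel (\<lambda>x. ennreal (h x) * indicator {u..v} x)) {x<..}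
      = ennreal (if max u x \<le> v then integral {u..v} h - integral {u..max u x} h else 0)"
    if h: "h \<in> borel_measurable borel" "\<And>x. 0 \<le> h x" "(\<integral>\<^sup>+x\<in>{u..v}. ennreal (h x) \<partial>lborel) < \<infinity>"
    for h :: "real \<Rightarrow> real" and x
  proof -
    have hint: "h integrable_on {u..v}" by (rule nn_integral_Icc_eq_integral(1)[OF h])
    have "emeasure (density lborel (\<lambda>x. ennreal (h x) * indicator {u..v} x)) {x<..}
      = (\<integral>\<^sup>+t. ennreal (h t) * indicator {u..v} t * indicator {x<..} t \<partial>lborel)"
      using h by (subst emeasure_density) auto
    also have "\<dots> = (\<integral>\<^sup>+t\<in>{max u x..v}. ennreal (h t) \<partial>lborel)"
      by (intro nn_integral_cong_AE, use AE_lborel_singleton[of x] in eventually_elim)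
         (auto split: split_indicator)
    also have "\<dots> = ennreal (integral {max u x..v} h)"
    proof (rule nn_integral_Icc_eq_integral(2)[OF h(1,2)])
      have "(\<integral>\<^sup>+t\<in>{max u x..v}. ennreal (h t) \<partial>lborel) \<le> (\<integral>\<^sup>+t\<in>{u..v}. ennreal (h t) \<partial>lborel)"
        by (intro nn_integral_mono) (auto split: split_indicator)
      then show "(\<integral>\<^sup>+t\<in>{max u x..v}. ennreal (h t) \<partial>lborel) < \<infinity>" using h(3) by (rule le_less_trans)
    qed
    also have "integral {max u x..v} h = (if max u x \<le> v then integral {u..v} h - integral {u..max u x} h else 0)"
      using Henstock_Kurzweil_Integration.integral_combine[of u "max u x" v h] hint by auto
    finally show ?thesis .
  qed
  have "density lborel (\<lambda>x. ennreal (f x) * indicator {u..v} x)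
      = density lborel (\<lambda>x. ennreal (g x) * indicator {u..v} x)"
  proof (rule measure_eqI_lessThan)
    fix x
    show "emeasure (density lborel (\<lambda>x. ennreal (f x) * indicator {u..v} x)) {x<..} < \<infinity>"
      by (simp add: ray[OF f])
    show "emeasure (density lborel (\<lambda>x. ennreal (f x) * indicator {u..v} x)) {x<..}
      = emeasure (density lborel (\<lambda>x. ennreal (g x) * indicator {u..v} x)) {x<..}"
      unfolding ray[OF f] ray[OF g] using eq[of v] eq[of "max u x"] by auto
  qed auto
  then have "AE x in lborel. ennreal (f x) * indicator {u..v} x = ennreal (g x) * indicator {u..v} x"
    using f g by (intro sigma_finite_measure.density_unique[OF sigma_finite_lborel]) auto
  then show ?thesis
    by eventually_elim (auto split: split_indicator_asm simp: f(2) g(2))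
qed

text \<open>A server works on at most one job at a time. The function \<open>f\<close> is arbitrary
  because the bound is applied to speeds and to powers.\<close>

lemma sum_rate_le_sum:
  assumes F: "finite F" and f: "\<And>k. k < m \<Longrightarrow> 0 \<le> f k t"
  shows "(\<Sum>j\<in>F. rate m f asg j t) \<le> (\<Sum>k<m. f k t)"
proof -
  have "(\<Sum>j\<in>F. rate m f asg j t) = (\<Sum>k<m. \<Sum>j\<in>F. if asg k t = Some j then f k t else 0)"
    unfolding rate_def by (rule sum.swap)
  also have "\<dots> \<le> (\<Sum>k<m. f k t)"
  proof (rule sum_mono)
    fix k assume k: "k \<in> {..<m}"
    have "(\<Sum>j\<in>F. if asg k t = Some j then f k t else 0)
        = (\<Sum>j\<in>F \<inter> {j. asg k t = Some j}. f k t)"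
      using F by (simp add: sum.If_cases)
    also have "F \<inter> {j. asg k t = Some j} \<subseteq> set_option (asg k t)" by auto
    then have "card (F \<inter> {j. asg k t = Some j}) \<le> 1"
      using card_mono[of "set_option (asg k t)" "F \<inter> {j. asg k t = Some j}"]
      by (cases "asg k t") auto
    then have "(\<Sum>j\<in>F \<inter> {j. asg k t = Some j}. f k t) \<le> 1 * f k t"
      using k f[of k] unfolding sum_constant by (intro mult_right_mono) auto
    finally show "(\<Sum>j\<in>F. if asg k t = Some j then f k t else 0) \<le> f k t" by simp
  qed
  finally show ?thesis .
qed

text \<open>Local integrability of the speed makes the work done real-valued and continuous in time.
  It follows from bounded speeds for the algorithm and from finite energy for the
  competitor.\<close>

locale schedule =
  fixes m :: nat and J :: "'j set" and a w :: "'j \<Rightarrow> real"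
    and sp :: "nat \<Rightarrow> real \<Rightarrow> real" and asg :: "nat \<Rightarrow> real \<Rightarrow> 'j option"
  assumes m: "1 \<le> m" and finite_jobs: "finite J" and size_pos: "\<And>j. j \<in> J \<Longrightarrow> 0 < w j"
    and feas: "feasible m J a sp asg"
    and locally_finite: "\<And>u v. (\<integral>\<^sup>+x\<in>{u..v}. ennreal (\<Sum>k<m. sp k x) \<partial>lborel) < \<infinity>"
begin

abbreviation "total_speed t \<equiv> \<Sum>k<m. sp k t"
abbreviation "job_rate \<equiv> rate m sp asg"
abbreviation "open_jobs \<equiv> unfinished m J a w sp asg"

lemma speed_nonneg: "k < m \<Longrightarrow> 0 \<le> sp k t"
  and speed_measurable: "k < m \<Longrightarrow> sp k \<in> borel_measurable borel"
  and assigned_measurable: "k < m \<Longrightarrow> {t. asg k t = Some j} \<in> sets borel"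
  and assignedD: "k < m \<Longrightarrow> asg k t = Some j \<Longrightarrow> j \<in> J \<and> a j \<le> t"
  using feas unfolding feasible_def by auto

lemma assigned_once: "k < m \<Longrightarrow> k' < m \<Longrightarrow> asg k t = Some j \<Longrightarrow> asg k' t = Some j \<Longrightarrow> k = k'"
  using feas unfolding feasible_def by fastforce

lemma rate_assigned:
  assumes k: "k < m" "asg k t = Some j"
  shows "rate m f asg j t = f k t"
proof -
  have "rate m f asg j t = (\<Sum>k'<m. if k' = k then f k t else 0)"
    unfolding rate_def
  proof (rule sum.cong[OF refl])
    fix k' assume "k' \<in> {..<m}"
    then show "(if asg k' t = Some j then f k' t else 0) = (if k' = k then f k t else 0)"
      using k assigned_once[of k' k t j] by (cases "k' = k") auto
  qed
  then show ?thesis using k by simp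
qed

lemma total_speed_nonneg: "0 \<le> total_speed t"
  by (intro sum_nonneg) (auto simp: speed_nonneg)

lemma rate_nonneg: "0 \<le> job_rate j t"
  unfolding rate_def by (intro sum_nonneg) (auto simp: speed_nonneg)

lemma rate_measurable_of:
  assumes "\<And>k. k < m \<Longrightarrow> f k \<in> borel_measurable borel"
  shows "rate m f asg j \<in> borel_measurable borel"
proof -
  have "(\<lambda>t. if asg k t = Some j then f k t else 0) \<in> borel_measurable borel" if "k < m" for k
    using assms[OF that] assigned_measurable[OF that]
    by (intro measurable_If) (auto simp: pred_def)
  then show ?thesis unfolding rate_def[abs_def] by (intro borel_measurable_sum) auto
qed

lemma rate_measurable: "job_rate j \<in> borel_measurable borel"
  by (rule rate_measurable_of) (rule speed_measurable)

lemma total_speed_measurable: "total_speed \<in> borel_measurable borel"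
  by (intro borel_measurable_sum) (auto simp: speed_measurable)

lemma rate_before_release: "t < a j \<Longrightarrow> job_rate j t = 0"
  unfolding rate_def by (intro sum.neutral) (auto dest: assignedD)

lemma sum_rate_le: "F \<subseteq> J \<Longrightarrow> (\<Sum>j\<in>F. job_rate j t) \<le> total_speed t"
  using finite_subset[OF _ finite_jobs] by (intro sum_rate_le_sum) (auto simp: speed_nonneg)

lemma rate_le: "job_rate j t \<le> total_speed t"
  unfolding rate_def by (intro sum_mono) (auto simp: speed_nonneg)

lemma rate_locally_finite: "(\<integral>\<^sup>+x\<in>{u..v}. ennreal (job_rate j x) \<partial>lborel) < \<infinity>"
proof -
  have "(\<integral>\<^sup>+x\<in>{u..v}. ennreal (job_rate j x) \<partial>lborel) \<le> (\<integral>\<^sup>+x\<in>{u..v}. ennreal (total_speed x) \<partial>lborel)"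
    by (intro nn_integral_mono) (auto split: split_indicator intro!: ennreal_leI rate_le)
  then show ?thesis using locally_finite by (rule le_less_trans)
qed

lemmas rate_integrable = nn_integral_Icc_eq_integral(1)[OF rate_measurable rate_nonneg rate_locally_finite]
lemmas rate_nn_integral = nn_integral_Icc_eq_integral(2)[OF rate_measurable rate_nonneg rate_locally_finite]
lemmas total_integrable = nn_integral_Icc_eq_integral(1)[OF total_speed_measurable total_speed_nonneg locally_finite]
lemmas total_nn_integral = nn_integral_Icc_eq_integral(2)[OF total_speed_measurable total_speed_nonneg locally_finite]

definition work :: "'j \<Rightarrow> real \<Rightarrow> real" where
  "work j t = integral {a j..t} (job_rate j)"

lemma done_work_eq: "done_work m a sp asg j t = ennreal (work j t)"
  unfolding done_work_def work_def by (rule rate_nn_integral)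

lemma work_nonneg: "0 \<le> work j t"
  unfolding work_def by (intro integral_nonneg rate_integrable rate_nonneg)

lemma work_start: "t \<le> a j \<Longrightarrow> work j t = 0"
  unfolding work_def by (cases "t = a j") auto

lemma work_diff: "a j \<le> u \<Longrightarrow> u \<le> v \<Longrightarrow> work j v - work j u = integral {u..v} (job_rate j)"
  unfolding work_def
  using Henstock_Kurzweil_Integration.integral_combine[of "a j" u v "job_rate j"] rate_integrable by auto

lemma work_mono:
  assumes "u \<le> v"
  shows "work j u \<le> work j v"
proof (cases "a j \<le> u")
  case True
  have "0 \<le> integral {u..v} (job_rate j)" by (intro integral_nonneg rate_integrable rate_nonneg)
  with work_diff[OF True assms] show ?thesis by linarith
next
  case False
  with work_start[of u j] work_nonneg[of j v] show ?thesis by simp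
qed

lemma work_continuous: "continuous_on {a j..v} (work j)"
  unfolding work_def by (intro indefinite_integral_continuous_1 rate_integrable)

lemma open_jobs_iff: "j \<in> open_jobs t \<longleftrightarrow> j \<in> J \<and> a j \<le> t \<and> work j t < w j"
  unfolding unfinished_def done_work_eq using work_nonneg[of j t]
  by (auto simp: ennreal_less_iff)

lemma finite_open_jobs: "finite (open_jobs t)"
  using finite_jobs finite_subset[of "open_jobs t" J] open_jobs_iff by auto

lemma remaining_eq: "remaining m a w sp asg j t = w j - work j t"
  unfolding remaining_def done_work_eq using work_nonneg by simp

text \<open>Work is continuous and monotone, so a job that is ever completed has a first completion
  time \<open>c\<close>, the least element of a closed level set, and it is unfinished exactly on
  \<open>{a j..<c}\<close>.\<close>

lemma completion_cases:
  assumes "j \<in> J"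
  obtains "\<And>t. j \<in> open_jobs t \<longleftrightarrow> a j \<le> t"
  | c where "\<And>t. j \<in> open_jobs t \<longleftrightarrow> a j \<le> t \<and> t < c" "a j < c" "work j c = w j"
proof (cases "\<exists>t. w j \<le> work j t")
  case False
  then show ?thesis using that(1) assms by (auto simp: open_jobs_iff not_le)
next
  case True
  then obtain v where v: "w j \<le> work j v" by blast
  have wj: "0 < w j" using size_pos assms by simp
  have av: "a j \<le> v" using v work_start[of v j] wj by (cases "a j \<le> v") auto
  define C where "C = {t \<in> {a j..v}. work j t = w j}"
  have "\<exists>t. a j \<le> t \<and> t \<le> v \<and> work j t = w j"
    using v av wj work_start[of "a j" j] work_continuous by (intro IVT') auto
  then have C: "C \<noteq> {}" by (auto simp: C_def)
  have "closed C" unfolding C_def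
    by (rule continuous_closed_preimage_constant[OF work_continuous]) auto
  moreover have bdd: "bdd_below C" by (auto simp: C_def bdd_below_def)
  ultimately have cin: "Inf C \<in> C" using C by (intro closed_contains_Inf)
  define c where "c = Inf C"
  have c: "a j \<le> c" "c \<le> v" "work j c = w j" using cin by (auto simp: C_def c_def)
  have ac: "a j < c" using c work_start[of c j] wj by (cases "c = a j") auto
  have "j \<in> open_jobs t \<longleftrightarrow> a j \<le> t \<and> t < c" for t
  proof (cases "t < c")
    case True
    have "work j t < w j" if "a j \<le> t"
    proof (rule ccontr)
      assume "\<not> work j t < w j"
      moreover have "work j t \<le> w j" using work_mono[of t c j] True c by simp
      ultimately have "t \<in> C" using that True c by (auto simp: C_def)
      then show False using cInf_lower[OF _ bdd] True by (force simp: c_def)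
    qed
    then show ?thesis using True assms by (auto simp: open_jobs_iff)
  next
    case False
    then show ?thesis using work_mono[of c t j] c by (auto simp: open_jobs_iff)
  qed
  then show ?thesis using that(2) ac c by blast
qed

text \<open>The events are releases and completions. Jobs are unfinished on half-open intervals
  closed at the left, so the status at \<open>s\<close> persists up to but excluding
  \<open>t\<close> even if \<open>s\<close> or \<open>t\<close> is itself an event.\<close>

lemma exists_events:
  obtains E where "finite E" "a ` J \<subseteq> E"
    "\<And>s t u. s \<le> u \<Longrightarrow> u < t \<Longrightarrow> E \<inter> {s<..<t} = {} \<Longrightarrow> open_jobs u = open_jobs s"
proof -
  define stable where "stable j c \<longleftrightarrow> (\<forall>s t u. s \<le> u \<longrightarrow> u < t \<longrightarrow> a j \<notin> {s<..<t} \<longrightarrow> c \<notin> {s<..<t}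
      \<longrightarrow> (j \<in> open_jobs u \<longleftrightarrow> j \<in> open_jobs s))" for j c
  have "\<exists>c. stable j c" if "j \<in> J" for j
  proof (cases rule: completion_cases[OF that])
    case 1
    \<comment> \<open>A job that is never completed has no completion event; any number may stand in
      for it.\<close>
    show ?thesis unfolding stable_def 1 by (intro exI[of _ 0]) auto
  next
    case (2 c)
    have "stable j c" unfolding stable_def 2(1)
    proof (intro allI impI)
      fix s t u :: real
      assume "s \<le> u" "u < t" "a j \<notin> {s<..<t}" "c \<notin> {s<..<t}"
      then show "(a j \<le> u \<and> u < c) = (a j \<le> s \<and> s < c)" by auto
    qed
    then show ?thesis by blast
  qed
  then obtain c where c: "\<And>j. j \<in> J \<Longrightarrow> stable j (c j)" by metis
  show ?thesis
  proof (rule that[of "a ` J \<union> c ` J"])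
    fix s t u :: real assume *: "s \<le> u" "u < t" "(a ` J \<union> c ` J) \<inter> {s<..<t} = {}"
    have "j \<in> open_jobs u \<longleftrightarrow> j \<in> open_jobs s" for j
    proof (cases "j \<in> J")
      case True
      then have "a j \<notin> {s<..<t}" "c j \<notin> {s<..<t}" using *(3) by blast+
      with *(1,2) c[OF True] show ?thesis unfolding stable_def by blast
    qed (auto simp: open_jobs_iff)
    then show "open_jobs u = open_jobs s" by blast
  qed (use finite_jobs in auto)
qed

lemma open_jobs_measurable: "{t. j \<in> open_jobs t} \<in> sets borel"
proof (cases "j \<in> J")
  case True
  show ?thesis
  proof (cases rule: completion_cases[OF True])
    case 1
    have "{t. j \<in> open_jobs t} = {a j..}" unfolding 1 by auto
    then show ?thesis by simp
  next
    case (2 c)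
    have "{t. j \<in> open_jobs t} = {a j..<c}" unfolding 2(1) by auto
    then show ?thesis by simp
  qed
qed (simp add: open_jobs_iff)

lemma card_open_jobs_eq: "real (card (open_jobs t)) = (\<Sum>j\<in>J. indicator {t. j \<in> open_jobs t} t)"
proof -
  have "{j \<in> J. j \<in> open_jobs t} = open_jobs t" by (auto simp: open_jobs_iff)
  then show ?thesis using finite_jobs by (simp add: indicator_def sum.If_cases Int_def)
qed

lemma card_open_jobs_measurable: "(\<lambda>t. real (card (open_jobs t))) \<in> borel_measurable borel"
  unfolding card_open_jobs_eq using open_jobs_measurable by (intro borel_measurable_sum) auto

section \<open>Residual sizes in an arbitrary schedule\<close>

definition released :: "real \<Rightarrow> 'j set" where
  "released t = {j \<in> J. a j \<le> t}"

text \<open>Truncated at 0 because a feasible schedule may keep processing a finished job, so that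
  the work done on it exceeds its size.\<close>

definition residual :: "real \<Rightarrow> 'j \<Rightarrow> real" where
  "residual t j = max 0 (w j - work j t)"

lemma residual_nonneg: "0 \<le> residual t j"
  by (simp add: residual_def)

lemma finite_released: "finite (released t)"
  using finite_jobs by (simp add: released_def)

lemma open_jobs_eq_residual: "open_jobs t = {j \<in> released t. 0 < residual t j}"
  by (auto simp: open_jobs_iff released_def residual_def)

lemma residual_at_release: "j \<in> J \<Longrightarrow> t \<le> a j \<Longrightarrow> residual t j = w j"
  using work_start[of t j] size_pos[of j] by (simp add: residual_def)

lemma bottom_residual_eq_0:
  assumes "s \<le> t" "card (open_jobs s) \<le> i"
  shows "bottom_work (released s) (residual t) i = 0"
proof (rule bottom_work_eq_0)
  have "{j \<in> released s. 0 < residual t j} \<subseteq> open_jobs s"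
  proof
    fix j assume "j \<in> {j \<in> released s. 0 < residual t j}"
    with work_mono[OF assms(1), of j] show "j \<in> open_jobs s"
      by (auto simp: open_jobs_eq_residual residual_def)
  qed
  then have "card {j \<in> released s. 0 < residual t j} \<le> card (open_jobs s)"
    by (intro card_mono finite_open_jobs)
  with assms show "card {j \<in> released s. 0 < residual t j} \<le> i" by simp
qed (auto simp: finite_released residual_nonneg)

lemma bottom_residual_drop_le:
  assumes "s \<le> t"
  shows "bottom_work (released s) (residual s) i - integral {s..t} total_speed
      \<le> bottom_work (released s) (residual t) i"
proof (rule bottom_work_drop_le[OF finite_released])
  show "residual t j \<le> residual s j" for j
    using work_mono[OF assms, of j] by (simp add: residual_def)
  have "(\<Sum>j\<in>released s. residual s j - residual t j) \<le> (\<Sum>j\<in>released s. integral {s..t} (job_rate j))"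
  proof (rule sum_mono)
    fix j assume "j \<in> released s"
    then have "work j t - work j s = integral {s..t} (job_rate j)"
      using assms by (intro work_diff) (auto simp: released_def)
    then show "residual s j - residual t j \<le> integral {s..t} (job_rate j)"
      using work_mono[OF assms, of j] by (auto simp: residual_def)
  qed
  also have "\<dots> = integral {s..t} (\<lambda>x. \<Sum>j\<in>released s. job_rate j x)"
    by (rule integral_sum[symmetric]) (auto simp: finite_released rate_integrable)
  also have "\<dots> \<le> integral {s..t} total_speed"
    by (intro integral_le integrable_sum rate_integrable total_integrable sum_rate_le finite_released)
       (auto simp: released_def)
  finally show "(\<Sum>j\<in>released s. residual s j - residual t j) \<le> integral {s..t} total_speed" .
qed

end

section \<open>SRPT schedules\<close>

lemma integral_ge_const_AE:
  fixes f :: "real \<Rightarrow> real"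
  assumes f: "f \<in> borel_measurable borel" "\<And>x. 0 \<le> f x" "(\<integral>\<^sup>+x\<in>{s..t}. ennreal (f x) \<partial>lborel) < \<infinity>"
    and st: "s \<le> t" and c: "0 \<le> c" and ge: "AE x in lborel. x \<in> {s..<t} \<longrightarrow> c \<le> f x"
  shows "c * (t - s) \<le> integral {s..t} f"
proof -
  have "ennreal (c * (t - s)) = (\<integral>\<^sup>+x\<in>{s..t}. ennreal c \<partial>lborel)"
    using st c by (simp add: nn_integral_cmult_indicator ennreal_mult)
  also have "\<dots> \<le> (\<integral>\<^sup>+x\<in>{s..t}. ennreal (f x) \<partial>lborel)"
    by (intro nn_integral_mono_AE, use AE_lborel_singleton[of t] ge in eventually_elim)
       (auto split: split_indicator intro!: ennreal_leI)
  also have "\<dots> = ennreal (integral {s..t} f)" by (rule nn_integral_Icc_eq_integral(2)[OF f])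
  finally show ?thesis
    using integral_nonneg[OF nn_integral_Icc_eq_integral(1)[OF f] f(2)] by (simp add: ennreal_le_iff)
qed

lemma (in power_function) srpt_speed_pos: "1 \<le> m \<Longrightarrow> 0 < srpt_speed m n"
  by (auto simp: srpt_speed_def intro!: Pinv_pos)

lemma (in power_function) srpt_speed_mono:
  assumes "1 \<le> m" "n \<le> N"
  shows "srpt_speed m n \<le> srpt_speed m N"
proof -
  have "Pinv P (real n / real m) \<le> Pinv P (real N / real m)"
    using assms by (intro Pinv_mono divide_right_mono) auto
  moreover have "Pinv P 1 \<le> Pinv P (real N / real m)" if "m \<le> N"
    using assms that by (intro Pinv_mono) auto
  ultimately show ?thesis using assms by (auto simp: srpt_speed_def)
qed

locale srpt_schedule = power_function P + schedule m J a w sp asg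
  for P :: "real \<Rightarrow> real" and m :: nat and J :: "'j set" and a w :: "'j \<Rightarrow> real"
    and sp :: "nat \<Rightarrow> real \<Rightarrow> real" and asg :: "nat \<Rightarrow> real \<Rightarrow> 'j option" +
  assumes alg: "alg_schedule P m J a w sp asg"
begin

definition serving :: "real \<Rightarrow> 'j set" where
  "serving t = {j. \<exists>k<m. asg k t = Some j}"

abbreviation "speed t \<equiv> srpt_speed m (card (open_jobs t))"

lemma serving_subset: "serving t \<subseteq> open_jobs t"
  and card_serving: "card (serving t) = min m (card (open_jobs t))"
  and serving_order_raw: "j \<in> serving t \<Longrightarrow> i \<in> open_jobs t - serving t \<Longrightarrow> w j - work j t \<le> w i - work i t"
  and idle_speed: "k < m \<Longrightarrow> asg k t = None \<Longrightarrow> sp k t = 0"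
  and busy_speed: "k < m \<Longrightarrow> asg k t = Some j \<Longrightarrow> sp k t = speed t"
  using alg unfolding alg_schedule_def Let_def serving_def remaining_eq srpt_speed_def by auto

lemma rate_eq: "job_rate j t = (if j \<in> serving t then speed t else 0)"
proof (cases "j \<in> serving t")
  case True
  then obtain k where k: "k < m" "asg k t = Some j" by (auto simp: serving_def)
  have "job_rate j t = sp k t" by (rule rate_assigned[OF k])
  then show ?thesis using True busy_speed[OF k] by simp
next
  case False
  then have "job_rate j t = 0" unfolding rate_def by (intro sum.neutral) (auto simp: serving_def)
  with False show ?thesis by simp
qed

text \<open>Busy servers and served jobs correspond bijectively, since no job runs on two servers.
  Applied to speeds and to powers.\<close>

lemma sum_servers:
  fixes f :: "nat \<Rightarrow> real"
  assumes "\<And>k. k < m \<Longrightarrow> asg k t = None \<Longrightarrow> f k = 0"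
    and "\<And>k j. k < m \<Longrightarrow> asg k t = Some j \<Longrightarrow> f k = c"
  shows "(\<Sum>k<m. f k) = real (min m (card (open_jobs t))) * c"
proof -
  define B where "B = {k \<in> {..<m}. asg k t \<noteq> None}"
  have "(\<Sum>k<m. f k) = (\<Sum>k\<in>B. c)"
    using assms by (intro sum.mono_neutral_cong_right) (auto simp: B_def)
  moreover have "bij_betw (\<lambda>k. the (asg k t)) B (serving t)"
    unfolding bij_betw_def
  proof
    show "inj_on (\<lambda>k. the (asg k t)) B" using assigned_once by (fastforce simp: inj_on_def B_def)
    show "(\<lambda>k. the (asg k t)) ` B = serving t" by (force simp: B_def serving_def image_iff)
  qed
  then have "card B = min m (card (open_jobs t))" using bij_betw_same_card card_serving by metis
  ultimately show ?thesis by simp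
qed

lemma total_speed_eq: "total_speed t = real (min m (card (open_jobs t))) * speed t"
  by (rule sum_servers) (auto simp: idle_speed busy_speed)

text \<open>Either \<open>m\<close> servers draw power \<open>n / m\<close> each, or
  \<open>n\<close> servers draw power 1 each.\<close>

lemma total_power_eq: "(\<Sum>k<m. P (sp k t)) = real (card (open_jobs t))"
proof -
  have "(\<Sum>k<m. P (sp k t)) = real (min m (card (open_jobs t))) * P (speed t)"
    by (rule sum_servers) (auto simp: idle_speed busy_speed P_zero)
  also have "\<dots> = real (card (open_jobs t))"
    using m by (auto simp: srpt_speed_def P_Pinv)
  finally show ?thesis .
qed

text \<open>Only unfinished jobs are served, so the work on a job is constant after its completion.
  For the algorithm the truncation in \<open>residual\<close> therefore has no effect.\<close>

lemma work_le_size: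
  assumes "j \<in> J"
  shows "work j t \<le> w j"
proof (cases rule: completion_cases[OF assms])
  case 1
  show ?thesis
  proof (cases "a j \<le> t")
    case True
    with 1 have "j \<in> open_jobs t" by blast
    then show ?thesis by (simp add: open_jobs_iff)
  next
    case False
    then show ?thesis using work_start[of t j] size_pos[OF assms] by simp
  qed
next
  case (2 c)
  show ?thesis
  proof (cases "t \<le> c")
    case True
    then show ?thesis using work_mono[of t c j] 2(3) by simp
  next
    case False
    have zero: "job_rate j x = 0" if "c \<le> x" for x
      using that 2(1)[of x] serving_subset[of x] by (auto simp: rate_eq)
    have "work j t - work j c = integral {c..t} (job_rate j)"
      using False 2(2) by (intro work_diff) auto
    also have "\<dots> = integral {c..t} (\<lambda>_. 0)" using zero by (intro integral_cong) auto
    finally show ?thesis using 2(3) by simp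
  qed
qed

lemma residual_eq: "j \<in> J \<Longrightarrow> residual t j = w j - work j t"
  using work_le_size[of j t] by (simp add: residual_def)

lemma open_jobs_subset: "open_jobs t \<subseteq> J"
  by (auto simp: open_jobs_iff)

lemma serving_order:
  assumes "j \<in> serving t" "i \<in> open_jobs t" "i \<notin> serving t"
  shows "residual t j \<le> residual t i"
proof -
  have "j \<in> J" "i \<in> J" using assms serving_subset[of t] open_jobs_subset[of t] by auto
  then show ?thesis using serving_order_raw[of j t i] assms by (simp add: residual_eq)
qed

lemma residual_continuous:
  assumes "j \<in> J" "a j \<le> u"
  shows "continuous_on {u..v} (\<lambda>x. residual x j)"
proof -
  have "continuous_on {u..v} (work j)"
    using assms(2) by (intro continuous_on_subset[OF work_continuous[of j v]]) auto
  then show ?thesis unfolding residual_eq[OF assms(1)] by (intro continuous_intros)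
qed

section \<open>SRPT on an interval with a fixed set of unfinished jobs\<close>

context
  fixes s t :: real and U :: "'j set"
  assumes st: "s < t" and steady: "\<And>u. s \<le> u \<Longrightarrow> u < t \<Longrightarrow> open_jobs u = U"
begin

lemma steady_released: "j \<in> U \<Longrightarrow> j \<in> J \<and> a j \<le> s"
  using steady[of s] st by (auto simp: open_jobs_iff)

lemma residual_diff:
  assumes "j \<in> U" "s \<le> u" "u \<le> v"
  shows "residual u j - residual v j = integral {u..v} (job_rate j)"
  using steady_released[OF assms(1)] assms work_diff[of j u v] by (simp add: residual_eq)

text \<open>SRPT widens every strict gap, since the shorter of two jobs is served whenever the longer one is.\<close>

lemma strict_order_preserved:
  assumes j: "j \<in> U" and j': "j' \<in> U" and uv: "s \<le> u" "u \<le> v" "v \<le> t"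
    and less: "residual u j < residual u j'"
  shows "residual v j < residual v j'"
proof (rule ccontr)
  assume "\<not> residual v j < residual v j'"
  \<comment> \<open>The times at which the order is violated. Before the first such time
    \<open>z\<close> the shorter job \<open>j\<close> is strictly shorter, hence served whenever
    \<open>j'\<close> is, so the gap cannot have closed at \<open>z\<close>.\<close>
  define C where "C = {u..v} \<inter> (\<lambda>x. residual x j' - residual x j) -` {..0}"
  have cont: "continuous_on {u..v} (\<lambda>x. residual x j' - residual x j)"
    using steady_released[OF j] steady_released[OF j'] uv
    by (intro continuous_intros residual_continuous) auto
  have "v \<in> C" using \<open>\<not> _\<close> uv by (auto simp: C_def)
  then have C: "C \<noteq> {}" by blast
  have "closed C" unfolding C_def using cont by (rule continuous_closed_preimage) auto
  moreover have bdd: "bdd_below C" by (auto simp: C_def bdd_below_def)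
  ultimately have zC: "Inf C \<in> C" using C by (intro closed_contains_Inf)
  define z where "z = Inf C"
  have z: "u \<le> z" "z \<le> v" "residual z j' \<le> residual z j" using zC by (auto simp: C_def z_def)
  have before: "residual x j < residual x j'" if "x \<in> {u<..<z}" for x
  proof (rule ccontr)
    assume "\<not> residual x j < residual x j'"
    then have "x \<in> C" using that z by (auto simp: C_def)
    then show False using cInf_lower[OF _ bdd, of x] that by (auto simp: z_def)
  qed
  have "integral {u<..<z} (job_rate j') \<le> integral {u<..<z} (job_rate j)"
  proof (rule integral_le)
    show "job_rate j' integrable_on {u<..<z}" "job_rate j integrable_on {u<..<z}"
      using rate_integrable integrable_on_open_interval_real by blast+
    fix x assume x: "x \<in> {u<..<z}"
    then have U: "open_jobs x = U" using uv z by (intro steady) auto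
    have "j \<in> serving x" if "j' \<in> serving x"
      using serving_order[OF that, of j] before[OF x] j U by auto
    then show "job_rate j' x \<le> job_rate j x"
      using srpt_speed_nonneg by (auto simp: rate_eq)
  qed
  then have "residual u j' - residual z j' \<le> residual u j - residual z j"
    using residual_diff[OF j, of u z] residual_diff[OF j', of u z] uv z
    by (simp add: integral_open_interval_real)
  with z less show False by simp
qed

text \<open>Since strict orders persist, the times at which two jobs are tied form an initial
  segment \<open>{s..z}\<close> if there are any. On it both jobs have lost the same amount since
  \<open>s\<close> at every time, so their rates have equal indefinite integrals and agree almost
  everywhere.\<close>

lemma AE_tied_jobs_same_rate:
  assumes j: "j \<in> U" and j': "j' \<in> U"
  shows "AE x in lborel. x \<in> {s..<t} \<longrightarrow> residual x j = residual x j' \<longrightarrow> job_rate j x = job_rate j' x"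
proof -
  define Z where "Z = {x \<in> {s..t}. residual x j' - residual x j = 0}"
  show ?thesis
  proof (cases "Z = {}")
    case True
    have "residual x j \<noteq> residual x j'" if "x \<in> {s..<t}" for x
    proof
      assume "residual x j = residual x j'"
      then have "x \<in> Z" using that by (simp add: Z_def)
      with True show False by simp
    qed
    then show ?thesis by simp
  next
    case False
    have "continuous_on {s..t} (\<lambda>x. residual x j' - residual x j)"
      using steady_released[OF j] steady_released[OF j'] by (intro continuous_intros residual_continuous) auto
    then have "closed Z" unfolding Z_def by (rule continuous_closed_preimage_constant) auto
    moreover have bdd: "bdd_above Z" by (auto simp: Z_def bdd_above_def)
    ultimately have zZ: "Sup Z \<in> Z" using False by (intro closed_contains_Sup)
    define z where "z = Sup Z"
    have z: "s \<le> z" "z \<le> t" "residual z j' = residual z j" using zZ by (auto simp: Z_def z_def)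
    have tied: "residual x j = residual x j'" if "s \<le> x" "x \<le> z" for x
      using strict_order_preserved[OF j j', of x z] strict_order_preserved[OF j' j, of x z] that z
      by (cases "residual x j" "residual x j'" rule: linorder_cases) auto
    have "AE x in lborel. x \<in> {s..z} \<longrightarrow> job_rate j x = job_rate j' x"
    proof (rule AE_eq_of_indefinite_integrals_eq)
      fix x assume "s \<le> x" "x \<le> z"
      then show "integral {s..x} (job_rate j) = integral {s..x} (job_rate j')"
        using tied[of s] tied[of x] residual_diff[OF j, of s x] residual_diff[OF j', of s x] by simp
    qed (rule rate_measurable rate_nonneg rate_locally_finite)+
    then show ?thesis
    proof eventually_elim
      case (elim x)
      show ?case
      proof (intro impI)
        assume x: "x \<in> {s..<t}" "residual x j = residual x j'"
        then have "x \<in> Z" by (auto simp: Z_def)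
        then have "x \<le> z" unfolding z_def using bdd by (rule cSup_upper)
        with elim x show "job_rate j x = job_rate j' x" by auto
      qed
    qed
  qed
qed

text \<open>One set \<open>R\<close> of \<open>i\<close> jobs is largest at both endpoints, so the
  drop of the bottom work is exactly the work done outside \<open>R\<close>. At almost every time
  SRPT serves \<open>min m (card U - i)\<close> or more jobs outside \<open>R\<close>.\<close>

lemma bottom_residual_drop_ge:
  "bottom_work (released s) (residual t) i
     \<le> bottom_work (released s) (residual s) i - srpt_speed m (card U) * (t - s) * real (min m (card U - i))"
proof (cases "card U \<le> i")
  case True
  have "open_jobs s = U" using steady st by auto
  then have "bottom_work (released s) (residual t) i = 0"
    using True st by (intro bottom_residual_eq_0) auto
  moreover have "0 \<le> bottom_work (released s) (residual s) i"
    by (intro bottom_work_nonneg finite_released residual_nonneg)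
  ultimately show ?thesis using True by simp
next
  case False
  define F where "F = released s"
  define \<sigma> where "\<sigma> = srpt_speed m (card U)"
  have F: "finite F" by (simp add: F_def finite_released)
  have U: "U = {j \<in> F. 0 < residual s j}"
    using steady[of s] st by (simp add: open_jobs_eq_residual F_def)
  have finU: "finite U" using F U by simp
  have \<sigma>: "0 < \<sigma>" using m by (auto simp: \<sigma>_def intro: srpt_speed_pos)
  have speed_eq: "speed x = \<sigma>" if "x \<in> {s..<t}" for x using steady[of x] that by (simp add: \<sigma>_def)
  \<comment> \<open>\<open>R\<close> is chosen at the end of the interval. A strict order persists
    forward in time, so by contraposition the order at \<open>t\<close> holds, weakly, at all
    earlier times of the interval.\<close>
  obtain R where R: "R \<subseteq> U" "card R = i" and top: "\<And>j j'. j \<in> U - R \<Longrightarrow> j' \<in> R \<Longrightarrow> residual t j \<le> residual t j'"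
    using exists_largest_subset[OF finU, of i "residual t"] False by auto
  have order: "residual x j \<le> residual x j'" if "j \<in> U - R" "j' \<in> R" "x \<in> {s..<t}" for x j j'
    using strict_order_preserved[of j' j x t] top[OF that(1,2)] that R(1) by force
  have residual_s_0: "residual s j = 0" if "j \<in> F - U" for j
    using that residual_nonneg[of s j] by (auto simp: U)
  have residual_mono: "residual t j \<le> residual s j" for j
    using work_mono[of s t j] st by (simp add: residual_def)
  have residual_t_0: "residual t j = 0" if "j \<in> F - U" for j
    using residual_s_0[OF that] residual_mono[of j] residual_nonneg[of t j] by simp
  have RF: "R \<subseteq> F" using R U by auto
  have bot_t: "bottom_work F (residual t) i = sum (residual t) (F - R)"
    unfolding R(2)[symmetric]
  proof (rule bottom_work_eq_largest[OF F residual_nonneg RF])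
    fix j j' assume "j \<in> F - R" "j' \<in> R"
    then show "residual t j \<le> residual t j'"
      using top[of j j'] residual_t_0[of j] residual_nonneg[of t j'] by (cases "j \<in> U") auto
  qed
  have bot_s: "bottom_work F (residual s) i = sum (residual s) (F - R)"
    unfolding R(2)[symmetric]
  proof (rule bottom_work_eq_largest[OF F residual_nonneg RF])
    fix j j' assume "j \<in> F - R" "j' \<in> R"
    then show "residual s j \<le> residual s j'"
      using order[of j j' s] residual_s_0[of j] residual_nonneg[of s j'] st by (cases "j \<in> U") auto
  qed
  have "AE x in lborel. \<forall>j\<in>U. \<forall>j'\<in>U. x \<in> {s..<t} \<longrightarrow> residual x j = residual x j' \<longrightarrow> job_rate j x = job_rate j' x"
    using finU by (intro AE_finite_allI AE_tied_jobs_same_rate)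
  then have "AE x in lborel. x \<in> {s..<t} \<longrightarrow> \<sigma> * real (min m (card U - i)) \<le> (\<Sum>j\<in>U - R. job_rate j x)"
  proof eventually_elim
    case (elim x)
    show ?case
    proof
      assume x: "x \<in> {s..<t}"
      have Ux: "open_jobs x = U" using x steady by simp
      have card_UR: "card (U - R) = card U - i"
        using R finU by (simp add: card_Diff_subset finite_subset)
      \<comment> \<open>If no job of \<open>R\<close> is served, all served jobs lie outside
        \<open>R\<close>. If some job of \<open>R\<close> is served, an unserved job outside
        \<open>R\<close> would be tied with it but have a different rate, which is excluded almost
        everywhere.\<close>
      have "min m (card U - i) \<le> card ((U - R) \<inter> serving x)"
      proof (cases "serving x \<inter> R = {}")
        case True
        then have "(U - R) \<inter> serving x = serving x" using serving_subset[of x] Ux by auto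
        then show ?thesis using card_serving[of x] Ux by auto
      next
        case False
        then obtain j' where j': "j' \<in> serving x" "j' \<in> R" by auto
        have "j \<in> serving x" if j: "j \<in> U - R" for j
        proof (rule ccontr)
          assume nj: "j \<notin> serving x"
          have "residual x j' \<le> residual x j" using serving_order[OF j'(1), of j] j nj Ux by simp
          moreover have "residual x j \<le> residual x j'" using order[OF j j'(2) x] .
          ultimately have "residual x j = residual x j'" by (rule antisym[rotated])
          moreover have "j \<in> U" "j' \<in> U" using j j' R by auto
          ultimately have "job_rate j x = job_rate j' x" using elim x by blast
          then show False using nj j' \<sigma> speed_eq[OF x] by (simp add: rate_eq)
        qed
        then have "(U - R) \<inter> serving x = U - R" by auto
        then show ?thesis using card_UR by simp
      qed
      then have "\<sigma> * real (min m (card U - i)) \<le> \<sigma> * real (card ((U - R) \<inter> serving x))"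
        using \<sigma> by (intro mult_left_mono) auto
      also have "\<dots> = (\<Sum>j\<in>U - R. job_rate j x)"
        using finU speed_eq[OF x] by (simp add: rate_eq sum.If_cases)
      finally show "\<sigma> * real (min m (card U - i)) \<le> (\<Sum>j\<in>U - R. job_rate j x)" .
    qed
  qed
  then have "\<sigma> * real (min m (card U - i)) * (t - s) \<le> integral {s..t} (\<lambda>x. \<Sum>j\<in>U - R. job_rate j x)"
  proof (rule integral_ge_const_AE[rotated 5])
    have "(\<integral>\<^sup>+x\<in>{s..t}. ennreal (\<Sum>j\<in>U - R. job_rate j x) \<partial>lborel) \<le> (\<integral>\<^sup>+x\<in>{s..t}. ennreal (total_speed x) \<partial>lborel)"
      using steady_released
      by (intro nn_integral_mono) (auto split: split_indicator intro!: ennreal_leI sum_rate_le)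
    then show "(\<integral>\<^sup>+x\<in>{s..t}. ennreal (\<Sum>j\<in>U - R. job_rate j x) \<partial>lborel) < \<infinity>"
      using locally_finite by (rule le_less_trans)
  qed (use st \<sigma> in \<open>auto intro!: borel_measurable_sum sum_nonneg rate_measurable rate_nonneg\<close>)
  also have "\<dots> = (\<Sum>j\<in>U - R. integral {s..t} (job_rate j))"
    using finU by (intro integral_sum) (auto simp: rate_integrable)
  also have "\<dots> = (\<Sum>j\<in>U - R. residual s j - residual t j)"
    using residual_diff[of _ s t] st by (intro sum.cong) auto
  also have "\<dots> \<le> (\<Sum>j\<in>F - R. residual s j - residual t j)"
    using F U residual_mono by (intro sum_mono2) auto
  finally show ?thesis
    using bot_s bot_t by (simp add: F_def \<sigma>_def sum_subtractf mult_ac)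
qed

end

end

section \<open>Lower bounds on the cost of a schedule\<close>

lemma (in power_function) speed_le_one_plus_power: "0 \<le> s \<Longrightarrow> s \<le> 1 + P s"
  using P_ge[of s] P_nonneg[of s] by (cases "s \<le> 1") auto

lemma (in power_function) P_measurable:
  assumes "f \<in> borel_measurable borel" "\<And>t. 0 \<le> f t"
  shows "(\<lambda>t. P (f t)) \<in> borel_measurable borel"
proof -
  have "continuous_on UNIV (\<lambda>x. P (max 0 x))"
    by (rule continuous_on_compose2[OF P_continuous]) (auto intro!: continuous_intros)
  then have "(\<lambda>x. P (max 0 x)) \<in> borel_measurable borel" by (rule borel_measurable_continuous_onI)
  from measurable_compose[OF assms(1) this] show ?thesis using assms(2) by (simp add: max_def)
qed

lemma (in power_function) feasible_power_measurable:
  assumes "feasible m J a sp asg"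
  shows "(\<lambda>t. \<Sum>k<m. P (sp k t)) \<in> borel_measurable borel"
  using assms by (intro borel_measurable_sum P_measurable) (auto simp: feasible_def)

text \<open>Summing \<open>s \<le> 1 + P s\<close> over the servers bounds the total speed by
  \<open>m\<close> plus the total power.\<close>

lemma (in power_function) finite_power_imp_locally_finite:
  assumes feas: "feasible m J a sp asg" and fin: "(\<integral>\<^sup>+t. ennreal (\<Sum>k<m. P (sp k t)) \<partial>lborel) < \<infinity>"
  shows "(\<integral>\<^sup>+x\<in>{u..v}. ennreal (\<Sum>k<m. sp k x) \<partial>lborel) < \<infinity>"
proof -
  have nonneg: "0 \<le> sp k t" if "k < m" for k t using feas that by (auto simp: feasible_def)
  have "(\<integral>\<^sup>+x\<in>{u..v}. ennreal (\<Sum>k<m. sp k x) \<partial>lborel)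
      \<le> (\<integral>\<^sup>+x. ennreal (real m) * indicator {u..v} x + ennreal (\<Sum>k<m. P (sp k x)) \<partial>lborel)"
  proof (rule nn_integral_mono)
    fix x
    have "(\<Sum>k<m. sp k x) \<le> (\<Sum>k<m. 1 + P (sp k x))"
      by (intro sum_mono speed_le_one_plus_power nonneg) auto
    then have "(\<Sum>k<m. sp k x) \<le> real m + (\<Sum>k<m. P (sp k x))" by (simp add: sum.distrib)
    then have "ennreal (\<Sum>k<m. sp k x) \<le> ennreal (real m) + ennreal (\<Sum>k<m. P (sp k x))"
      using nonneg P_nonneg by (subst ennreal_plus[symmetric]) (auto intro!: sum_nonneg ennreal_leI)
    then show "ennreal (\<Sum>k<m. sp k x) * indicator {u..v} x
        \<le> ennreal (real m) * indicator {u..v} x + ennreal (\<Sum>k<m. P (sp k x))"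
      by (auto split: split_indicator)
  qed
  also have "\<dots> = ennreal (real m) * emeasure lborel {u..v} + (\<integral>\<^sup>+t. ennreal (\<Sum>k<m. P (sp k t)) \<partial>lborel)"
    using feasible_power_measurable[OF feas]
    by (subst nn_integral_add) (auto simp: nn_integral_cmult_indicator)
  also have "\<dots> < \<infinity>" using fin by (cases "u \<le> v") (auto simp: ennreal_mult_less_top)
  finally show ?thesis .
qed

text \<open>At most \<open>card J\<close> jobs are unfinished at any time, so all speeds stay below
  the speed for \<open>card J\<close> jobs.\<close>

lemma (in power_function) alg_locally_finite:
  assumes m: "1 \<le> m" and J: "finite J" and alg: "alg_schedule P m J a w sp asg"
  shows "(\<integral>\<^sup>+x\<in>{u..v}. ennreal (\<Sum>k<m. sp k x) \<partial>lborel) < \<infinity>"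
proof -
  define B where "B = srpt_speed m (card J)"
  have B0: "0 \<le> B" by (simp add: B_def srpt_speed_nonneg)
  have "sp k x \<le> B" if k: "k < m" for k x
  proof (cases "asg k x")
    case None
    then show ?thesis using alg k B0 by (auto simp: alg_schedule_def Let_def)
  next
    case (Some j)
    then have "sp k x = srpt_speed m (card (unfinished m J a w sp asg x))"
      using alg k by (auto simp: alg_schedule_def Let_def srpt_speed_def)
    also have "\<dots> \<le> B" unfolding B_def
      using J m by (intro srpt_speed_mono card_mono) (auto simp: unfinished_def)
    finally show ?thesis .
  qed
  then have "(\<Sum>k<m. sp k x) \<le> real m * B" for x
    using sum_bounded_above[of "{..<m}" "\<lambda>k. sp k x" B] by simp
  then have "(\<integral>\<^sup>+x\<in>{u..v}. ennreal (\<Sum>k<m. sp k x) \<partial>lborel) \<le> (\<integral>\<^sup>+x\<in>{u..v}. ennreal (real m * B) \<partial>lborel)"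
    by (intro nn_integral_mono) (auto split: split_indicator intro!: ennreal_leI)
  also have "\<dots> < \<infinity>"
    by (cases "u \<le> v") (auto simp: nn_integral_cmult_indicator ennreal_mult_less_top)
  finally show ?thesis .
qed

locale powered_schedule = power_function P + schedule m J a w sp asg
  for P :: "real \<Rightarrow> real" and m :: nat and J :: "'j set" and a w :: "'j \<Rightarrow> real"
    and sp :: "nat \<Rightarrow> real \<Rightarrow> real" and asg :: "nat \<Rightarrow> real \<Rightarrow> 'j option"
begin

abbreviation "total_power t \<equiv> \<Sum>k<m. P (sp k t)"

lemma total_power_measurable: "total_power \<in> borel_measurable borel"
  by (rule feasible_power_measurable[OF feas])

lemma total_power_nonneg: "0 \<le> total_power t"
  by (intro sum_nonneg P_nonneg speed_nonneg) auto

text \<open>Jensen's inequality over time and servers at once: the tangent of \<open>P\<close> at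
  the mean speed \<open>z\<close> per server is summed over servers and integrated, and the linear
  parts cancel. If the energy is infinite there is nothing to show.\<close>

lemma power_ge_at_mean_speed:
  assumes st: "s < t"
  shows "ennreal ((t - s) * (real m * P (integral {s..t} total_speed / (t - s) / real m)))
     \<le> (\<integral>\<^sup>+x\<in>{s..<t}. ennreal (total_power x) \<partial>lborel)" (is "_ \<le> ?E")
proof (cases "?E = \<infinity>")
  case False
  define V where "V = integral {s..t} total_speed"
  define z where "z = V / (t - s) / real m"
  have V0: "0 \<le> V" unfolding V_def by (intro integral_nonneg total_integrable total_speed_nonneg)
  have z0: "0 \<le> z" using V0 st by (simp add: z_def)
  obtain g where g: "0 \<le> g" "\<And>y. 0 \<le> y \<Longrightarrow> P z + g * (y - z) \<le> P y"
    using subgradient_exists[OF z0] by auto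
  have tangent: "real m * P z + g * total_speed x \<le> total_power x + g * (real m * z)" for x
  proof -
    have "(\<Sum>k<m. P z + g * (sp k x - z)) \<le> total_power x"
      by (intro sum_mono g speed_nonneg) auto
    then show ?thesis by (simp add: sum.distrib sum_distrib_left[symmetric] sum_subtractf algebra_simps)
  qed
  obtain e where e: "0 \<le> e" "?E = ennreal e" using False by (cases ?E) auto
  have Vnn: "(\<integral>\<^sup>+x\<in>{s..<t}. ennreal (total_speed x) \<partial>lborel) = ennreal V"
  proof -
    have "(\<integral>\<^sup>+x\<in>{s..<t}. ennreal (total_speed x) \<partial>lborel) = (\<integral>\<^sup>+x\<in>{s..t}. ennreal (total_speed x) \<partial>lborel)"
      by (intro nn_integral_cong_AE, use AE_lborel_singleton[of t] in eventually_elim)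
         (auto split: split_indicator)
    then show ?thesis unfolding V_def by (simp only: total_nn_integral)
  qed
  have const: "(\<integral>\<^sup>+x\<in>{s..<t}. ennreal c \<partial>lborel) = ennreal (c * (t - s))" if "0 \<le> c" for c
    using that st by (simp add: nn_integral_cmult_indicator ennreal_mult)
  have "ennreal (real m * P z * (t - s) + g * V)
      = (\<integral>\<^sup>+x\<in>{s..<t}. ennreal (real m * P z) \<partial>lborel) + ennreal g * (\<integral>\<^sup>+x\<in>{s..<t}. ennreal (total_speed x) \<partial>lborel)"
    unfolding Vnn using P_nonneg[OF z0] g V0 st
    by (subst const) (auto simp: ennreal_plus ennreal_mult)
  also have "\<dots> = (\<integral>\<^sup>+x\<in>{s..<t}. ennreal (real m * P z + g * total_speed x) \<partial>lborel)"
    using total_speed_measurable P_nonneg[OF z0] g total_speed_nonneg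
    by (subst nn_integral_cmult[symmetric], simp, subst nn_integral_add[symmetric])
       (auto simp: ennreal_plus ennreal_mult distrib_right mult.assoc intro!: nn_integral_cong)
  also have "\<dots> \<le> (\<integral>\<^sup>+x\<in>{s..<t}. ennreal (total_power x + g * (real m * z)) \<partial>lborel)"
    using tangent by (intro nn_integral_mono mult_right_mono ennreal_leI) auto
  also have "\<dots> = ?E + (\<integral>\<^sup>+x\<in>{s..<t}. ennreal (g * (real m * z)) \<partial>lborel)"
    using total_power_measurable z0 g total_power_nonneg
    by (subst nn_integral_add[symmetric]) (auto simp: ennreal_plus distrib_right intro!: nn_integral_cong)
  also have "\<dots> = ennreal (e + g * (real m * z) * (t - s))"
    using e g z0 st by (subst const) (auto simp: ennreal_plus)
  finally have "real m * P z * (t - s) + g * V \<le> e + g * (real m * z) * (t - s)"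
    using e g z0 st by (subst (asm) ennreal_le_iff) auto
  moreover have "real m * z * (t - s) = V" using st m by (simp add: z_def)
  ultimately have "(t - s) * (real m * P z) \<le> e" by (simp add: algebra_simps)
  then show ?thesis using e by (simp add: V_def z_def ennreal_leI)
qed simp

lemma rate_le_one_plus: "job_rate j x \<le> 1 + rate m (\<lambda>k t. P (sp k t)) asg j x"
proof (cases "\<exists>k<m. asg k x = Some j")
  case True
  then obtain k where k: "k < m" "asg k x = Some j" by blast
  show ?thesis unfolding rate_assigned[OF k] using speed_nonneg[OF k(1)] by (rule speed_le_one_plus_power)
next
  case False
  then have "rate m f asg j x = 0" for f unfolding rate_def by (intro sum.neutral) auto
  then show ?thesis by simp
qed

text \<open>While a job is unfinished its rate is at most 1 plus the power of the server running it;
  integrating up to completion gives the size. A job that is never completed stays open for longer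
  than \<open>w j\<close> time units anyway.\<close>

lemma size_le_flow_plus_power:
  assumes j: "j \<in> J"
  shows "ennreal (w j) \<le> (\<integral>\<^sup>+x. indicator {t. j \<in> open_jobs t} x \<partial>lborel)
     + (\<integral>\<^sup>+x. ennreal (rate m (\<lambda>k t. P (sp k t)) asg j x) \<partial>lborel)"
proof (cases rule: completion_cases[OF j])
  case 1
  have "ennreal (w j) = emeasure lborel {a j..a j + w j}" using size_pos[OF j] by simp
  also have "\<dots> \<le> emeasure lborel {t. j \<in> open_jobs t}"
    using open_jobs_measurable by (intro emeasure_mono) (auto simp: 1)
  also have "\<dots> = (\<integral>\<^sup>+x. indicator {t. j \<in> open_jobs t} x \<partial>lborel)"
    using open_jobs_measurable by simp
  finally show ?thesis by (rule order_trans) simp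
next
  case (2 c)
  have "ennreal (w j) = (\<integral>\<^sup>+x\<in>{a j..c}. ennreal (job_rate j x) \<partial>lborel)"
    unfolding 2(3)[symmetric] work_def by (rule rate_nn_integral[symmetric])
  also have "\<dots> \<le> (\<integral>\<^sup>+x. indicator {t. j \<in> open_jobs t} x + ennreal (rate m (\<lambda>k t. P (sp k t)) asg j x) \<partial>lborel)"
  proof (intro nn_integral_mono_AE, use AE_lborel_singleton[of c] in eventually_elim)
    case (elim x)
    show ?case
    proof (cases "x \<in> {a j..c}")
      case True
      with elim have "j \<in> open_jobs x" unfolding 2(1) by auto
      moreover have "0 \<le> rate m (\<lambda>k t. P (sp k t)) asg j x"
        unfolding rate_def by (intro sum_nonneg) (auto intro!: P_nonneg speed_nonneg)
      then have "ennreal (job_rate j x) \<le> 1 + ennreal (rate m (\<lambda>k t. P (sp k t)) asg j x)"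
        using ennreal_leI[OF rate_le_one_plus[of j x]] by (simp add: ennreal_plus)
      ultimately show ?thesis using True by simp
    qed simp
  qed
  also have "\<dots> = (\<integral>\<^sup>+x. indicator {t. j \<in> open_jobs t} x \<partial>lborel)
     + (\<integral>\<^sup>+x. ennreal (rate m (\<lambda>k t. P (sp k t)) asg j x) \<partial>lborel)"
    using open_jobs_measurable
    by (intro nn_integral_add measurable_compose[OF _ measurable_ennreal])
       (auto intro!: rate_measurable_of P_measurable simp: speed_measurable speed_nonneg)
  finally show ?thesis .
qed

text \<open>Summing the bounds for single jobs, the open times add up to the integral of the number
  of unfinished jobs, and each server's power is charged to at most one job.\<close>

lemma total_size_le_cost: "ennreal (\<Sum>j\<in>J. w j) \<le> cost P m J a w sp asg"
proof -
  have nonneg: "0 \<le> rate m (\<lambda>k t. P (sp k t)) asg j x" for j x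
    unfolding rate_def by (intro sum_nonneg) (auto intro!: P_nonneg speed_nonneg)
  have "ennreal (\<Sum>j\<in>J. w j) = (\<Sum>j\<in>J. ennreal (w j))"
    using size_pos by (intro sum_ennreal[symmetric]) (auto intro: less_imp_le)
  also have "\<dots> \<le> (\<Sum>j\<in>J. (\<integral>\<^sup>+x. indicator {t. j \<in> open_jobs t} x \<partial>lborel)
     + (\<integral>\<^sup>+x. ennreal (rate m (\<lambda>k t. P (sp k t)) asg j x) \<partial>lborel))"
    by (intro sum_mono size_le_flow_plus_power)
  also have "\<dots> = (\<Sum>j\<in>J. (\<integral>\<^sup>+x. indicator {t. j \<in> open_jobs t} x \<partial>lborel))
     + (\<Sum>j\<in>J. \<integral>\<^sup>+x. ennreal (rate m (\<lambda>k t. P (sp k t)) asg j x) \<partial>lborel)"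
    by (rule sum.distrib)
  also have "(\<Sum>j\<in>J. (\<integral>\<^sup>+x. indicator {t. j \<in> open_jobs t} x \<partial>lborel))
      = (\<integral>\<^sup>+x. (\<Sum>j\<in>J. indicator {t. j \<in> open_jobs t} x) \<partial>lborel)"
    using open_jobs_measurable by (intro nn_integral_sum[symmetric]) auto
  also have "\<dots> = (\<integral>\<^sup>+x. ennreal (real (card (open_jobs x))) \<partial>lborel)"
    unfolding card_open_jobs_eq
    by (intro nn_integral_cong, subst sum_ennreal[symmetric]) (auto simp: ennreal_indicator)
  also have "(\<Sum>j\<in>J. \<integral>\<^sup>+x. ennreal (rate m (\<lambda>k t. P (sp k t)) asg j x) \<partial>lborel)
      = (\<integral>\<^sup>+x. (\<Sum>j\<in>J. ennreal (rate m (\<lambda>k t. P (sp k t)) asg j x)) \<partial>lborel)"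
    by (intro nn_integral_sum[symmetric] measurable_compose[OF _ measurable_ennreal])
       (auto intro!: rate_measurable_of P_measurable simp: speed_measurable speed_nonneg)
  also have "\<dots> \<le> (\<integral>\<^sup>+x. ennreal (total_power x) \<partial>lborel)"
    using nonneg finite_jobs
    by (intro nn_integral_mono, subst sum_ennreal)
       (auto intro!: ennreal_leI sum_rate_le_sum P_nonneg speed_nonneg)
  finally show ?thesis unfolding cost_def by (simp add: add_left_mono)
qed

end

section \<open>The potential argument\<close>

text \<open>Induction on the number of points of \<open>E\<close> inside the interval, splitting at
  one of them.\<close>

lemma interval_chain:
  fixes Q :: "real \<Rightarrow> real \<Rightarrow> bool"
  assumes E: "finite E"
    and trans: "\<And>s t u. s < t \<Longrightarrow> t < u \<Longrightarrow> Q s t \<Longrightarrow> Q t u \<Longrightarrow> Q s u"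
    and step: "\<And>s t. s < t \<Longrightarrow> E \<inter> {s<..<t} = {} \<Longrightarrow> Q s t"
    and "s < t"
  shows "Q s t"
  using \<open>s < t\<close>
proof (induction "card (E \<inter> {s<..<t})" arbitrary: s t rule: less_induct)
  case less
  show ?case
  proof (cases "E \<inter> {s<..<t} = {}")
    case True
    then show ?thesis using step less.prems by blast
  next
    case False
    then obtain e where e: "e \<in> E" "s < e" "e < t" by auto
    have "E \<inter> {s<..<e} \<subset> E \<inter> {s<..<t}" "E \<inter> {e<..<t} \<subset> E \<inter> {s<..<t}" using e by auto
    then have "card (E \<inter> {s<..<e}) < card (E \<inter> {s<..<t})" "card (E \<inter> {e<..<t}) < card (E \<inter> {s<..<t})"
      using E by (auto intro!: psubset_card_mono)
    then have "Q s e" "Q e t" using less.hyps e by auto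
    then show ?thesis using trans e by blast
  qed
qed

lemma nn_integral_Ico_split:
  fixes f :: "real \<Rightarrow> ennreal"
  assumes "f \<in> borel_measurable borel" "s \<le> t" "t \<le> u"
  shows "(\<integral>\<^sup>+x\<in>{s..<u}. f x \<partial>lborel) = (\<integral>\<^sup>+x\<in>{s..<t}. f x \<partial>lborel) + (\<integral>\<^sup>+x\<in>{t..<u}. f x \<partial>lborel)"
proof -
  have "{s..<u} = {s..<t} \<union> {t..<u}" using assms by auto
  then show ?thesis using assms by (simp add: nn_integral_disjoint_pair)
qed

lemma nn_integral_Ico_const:
  assumes "s \<le> t" "0 \<le> c" "\<And>x. x \<in> {s..<t} \<Longrightarrow> f x = ennreal c"
  shows "(\<integral>\<^sup>+x\<in>{s..<t}. f x \<partial>lborel) = ennreal ((t - s) * c)"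
proof -
  have "(\<integral>\<^sup>+x\<in>{s..<t}. f x \<partial>lborel) = (\<integral>\<^sup>+x\<in>{s..<t}. ennreal c \<partial>lborel)"
    using assms(3) by (intro nn_integral_cong) (auto split: split_indicator)
  then show ?thesis using assms by (simp add: nn_integral_cmult_indicator ennreal_mult mult.commute)
qed

locale srpt_vs_schedule =
  alg: srpt_schedule P m J a w spA asgA + opt: powered_schedule P m J a w sp asg
  for P :: "real \<Rightarrow> real" and m :: nat and J :: "'j set" and a w :: "'j \<Rightarrow> real"
    and spA :: "nat \<Rightarrow> real \<Rightarrow> real" and asgA :: "nat \<Rightarrow> real \<Rightarrow> 'j option"
    and sp :: "nat \<Rightarrow> real \<Rightarrow> real" and asg :: "nat \<Rightarrow> real \<Rightarrow> 'j option" +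
  fixes \<Delta> :: "nat \<Rightarrow> real"
  assumes amortizes: "alg.amortizes m \<Delta>"
begin

text \<open>The range \<open>card J\<close> bounds the number of unfinished jobs at all times, so
  the same sum serves at every moment.\<close>

definition potential :: "real \<Rightarrow> real" where
  "potential t = (\<Sum>k<card J. (\<Delta> (Suc k) - \<Delta> k)
      * excess (alg.released t) (alg.residual t) (opt.residual t) k)"

abbreviation "nA t \<equiv> card (alg.open_jobs t)"
abbreviation "nO t \<equiv> card (opt.open_jobs t)"
abbreviation "ratio \<equiv> P (2 - 1 / real m)"

lemma increment_nonneg: "0 \<le> \<Delta> (Suc k) - \<Delta> k"
  using amortizes monoD[of \<Delta> k "Suc k"] by (simp add: alg.amortizes_def)

lemma excess_nonneg: "0 \<le> excess (alg.released t) (alg.residual t) (opt.residual t) k"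
  using excess_le_iff[of "alg.released t" "alg.residual t" "opt.residual t" k
      "excess (alg.released t) (alg.residual t) (opt.residual t) k"]
  by (auto simp: alg.finite_released alg.residual_nonneg opt.residual_nonneg)

lemma potential_nonneg: "0 \<le> potential t"
  unfolding potential_def by (intro sum_nonneg mult_nonneg_nonneg increment_nonneg excess_nonneg)

lemma ratio_ge_1: "1 \<le> ratio"
  using alg.P_two_minus_ge[OF alg.m] .

text \<open>The jobs released at \<open>s\<close> evolve by \<open>excess_step\<close>. The jobs
  added at \<open>t\<close> have arrived exactly at \<open>t\<close>, hence are untouched in both
  schedules, and \<open>excess_union_le\<close> adds them without any increase.\<close>

lemma excess_drift:
  assumes st: "s < t"
    and arrivals: "a ` J \<inter> {s<..<t} = {}"
    and steady: "\<And>u. s \<le> u \<Longrightarrow> u < t \<Longrightarrow> alg.open_jobs u = alg.open_jobs s"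
  defines "V \<equiv> integral {s..t} opt.total_speed"
  shows "excess (alg.released t) (alg.residual t) (opt.residual t) k
     \<le> excess (alg.released s) (alg.residual s) (opt.residual s) k
       + (if k < nA s then (t - s) * alg.level_drift m (nA s) (nO s) (V / (t - s)) k else 0)"
proof -
  define F where "F = alg.released s"
  define G where "G = {j \<in> J. s < a j \<and> a j \<le> t}"
  define c where "c = alg.srpt_speed m (nA s) * (t - s)"
  have c: "0 \<le> c" using st by (simp add: c_def alg.srpt_speed_nonneg)
  have G: "j \<in> J" "a j = t" if "j \<in> G" for j
    using that arrivals by (force simp: G_def)+
  have "alg.released t = F \<union> G" using st by (auto simp: F_def G_def alg.released_def)
  moreover have "excess (F \<union> G) (alg.residual t) (opt.residual t) k \<le> excess F (alg.residual t) (opt.residual t) k"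
  proof (rule excess_union_le)
    fix j assume "j \<in> G"
    then show "alg.residual t j = opt.residual t j"
      using G[of j] alg.residual_at_release[of j t] opt.residual_at_release[of j t] by simp
  qed (auto simp: F_def G_def alg.finite_released alg.finite_jobs alg.residual_nonneg opt.residual_nonneg alg.released_def)
  ultimately have "excess (alg.released t) (alg.residual t) (opt.residual t) k
      \<le> excess F (alg.residual t) (opt.residual t) k" by simp
  also have "\<dots> \<le> excess F (alg.residual s) (opt.residual s) k
     + (if k < nA s - nO s then V - c * real (min m (nA s - nO s - k))
        else if k < nA s then max 0 (V - c) else 0)"
  proof (rule excess_step)
    show "bottom_work F (alg.residual t) i
        \<le> bottom_work F (alg.residual s) i - c * real (min m (nA s - i))" for i
      unfolding F_def c_def using st steady by (rule alg.bottom_residual_drop_ge)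
    show "bottom_work F (opt.residual s) i - V \<le> bottom_work F (opt.residual t) i" for i
      unfolding F_def V_def using opt.bottom_residual_drop_le[of s t i] st by simp
    show "bottom_work F (alg.residual t) i = 0" if "nA s \<le> i" for i
      unfolding F_def using st that by (intro alg.bottom_residual_eq_0) auto
    show "bottom_work F (opt.residual t) i = 0" if "nO s \<le> i" for i
      unfolding F_def using st that by (intro opt.bottom_residual_eq_0) auto
  qed (use c alg.m in \<open>auto simp: F_def alg.finite_released alg.residual_nonneg opt.residual_nonneg\<close>)
  also have "(if k < nA s - nO s then V - c * real (min m (nA s - nO s - k))
        else if k < nA s then max 0 (V - c) else 0)
      = (if k < nA s then (t - s) * alg.level_drift m (nA s) (nO s) (V / (t - s)) k else 0)"
  proof -
    have "(t - s) * (V / (t - s) - alg.srpt_speed m (nA s) * y) = V - c * y" for y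
    proof -
      have "(t - s) * (V / (t - s)) = V" using st by simp
      then show ?thesis by (simp only: right_diff_distrib c_def mult_ac)
    qed
    moreover from this[of 1] have "(t - s) * max 0 (V / (t - s) - alg.srpt_speed m (nA s)) = max 0 (V - c)"
      using st by (simp add: max_mult_distrib_left)
    ultimately show ?thesis by (auto simp: alg.level_drift_def)
  qed
  finally show ?thesis by (simp add: F_def)
qed

lemma potential_drift:
  assumes st: "s < t"
    and arrivals: "a ` J \<inter> {s<..<t} = {}"
    and steady: "\<And>u. s \<le> u \<Longrightarrow> u < t \<Longrightarrow> alg.open_jobs u = alg.open_jobs s"
  defines "V \<equiv> integral {s..t} opt.total_speed"
  shows "potential t + (t - s) * real (nA s) \<le> potential s
     + ratio * ((t - s) * real (nO s) + (t - s) * (real m * P (V / (t - s) / real m)))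
     + ratio / Pinv P 1 * ((t - s) * alg.total_speed s)"
proof -
  define \<delta> where "\<delta> k = \<Delta> (Suc k) - \<Delta> k" for k
  define X where "X u k = excess (alg.released u) (alg.residual u) (opt.residual u) k" for u k
  define d where "d k = alg.level_drift m (nA s) (nO s) (V / (t - s)) k" for k
  have n_le: "nA s \<le> card J" using alg.open_jobs_subset alg.finite_jobs by (intro card_mono)
  have V0: "0 \<le> V" unfolding V_def
    by (intro integral_nonneg opt.total_integrable opt.total_speed_nonneg)
  have "potential t \<le> (\<Sum>k<card J. \<delta> k * (X s k + (if k < nA s then (t - s) * d k else 0)))"
    unfolding potential_def \<delta>_def X_def d_def V_def
    by (intro sum_mono mult_left_mono increment_nonneg excess_drift st arrivals steady)
  also have "\<dots> = potential s + (\<Sum>k<card J. \<delta> k * (if k < nA s then (t - s) * d k else 0))"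
    by (simp add: potential_def \<delta>_def X_def distrib_left sum.distrib)
  also have "(\<Sum>k<card J. \<delta> k * (if k < nA s then (t - s) * d k else 0)) = (\<Sum>k<nA s. \<delta> k * ((t - s) * d k))"
    using n_le by (intro sum.mono_neutral_cong_right) auto
  also have "\<dots> = (t - s) * (\<Sum>k<nA s. \<delta> k * d k)"
    by (simp add: sum_distrib_left mult_ac)
  finally have "potential t + (t - s) * real (nA s)
      \<le> potential s + (t - s) * (real (nA s) + (\<Sum>k<nA s. \<delta> k * d k))"
    by (simp add: algebra_simps)
  also have "\<dots> \<le> potential s + (t - s) * (ratio * (real (nO s) + real m * P (V / (t - s) / real m)
              + real (min m (nA s)) * alg.srpt_speed m (nA s) / Pinv P 1))"
  proof -
    have "0 \<le> V / (t - s)" using V0 st by simp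
    then have "real (nA s) + (\<Sum>k<nA s. \<delta> k * d k) \<le> ratio * (real (nO s) + real m * P (V / (t - s) / real m)
              + real (min m (nA s)) * alg.srpt_speed m (nA s) / Pinv P 1)"
      using amortizes unfolding alg.amortizes_def \<delta>_def d_def by blast
    then show ?thesis using st by (intro add_left_mono mult_left_mono) auto
  qed
  also have "\<dots> = potential s
     + ratio * ((t - s) * real (nO s) + (t - s) * (real m * P (V / (t - s) / real m)))
     + ratio / Pinv P 1 * ((t - s) * alg.total_speed s)"
    unfolding alg.total_speed_eq by (simp add: distrib_left mult_ac add_ac)
  finally show ?thesis .
qed

text \<open>Both potentials stand on the side where they are added, which avoids subtraction in
  \<open>ennreal\<close>; half-open intervals make the inequality chain over adjacent
  intervals.\<close>

definition amortized :: "real \<Rightarrow> real \<Rightarrow> bool" where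
  "amortized s t \<longleftrightarrow>
     ennreal (potential t) + (\<integral>\<^sup>+x\<in>{s..<t}. ennreal (real (nA x)) \<partial>lborel)
     \<le> ennreal (potential s)
       + ennreal ratio * ((\<integral>\<^sup>+x\<in>{s..<t}. ennreal (real (nO x)) \<partial>lborel)
           + (\<integral>\<^sup>+x\<in>{s..<t}. ennreal (opt.total_power x) \<partial>lborel))
       + ennreal (ratio / Pinv P 1) * (\<integral>\<^sup>+x\<in>{s..<t}. ennreal (alg.total_speed x) \<partial>lborel)"

text \<open>Both job counts and the algorithm's speed are constant between events. Only the
  competitor's power can vary, and it is bounded below through its mean speed.\<close>

lemma amortized_between_events:
  assumes st: "s < t"
    and arrivals: "a ` J \<inter> {s<..<t} = {}"
    and steadyA: "\<And>u. s \<le> u \<Longrightarrow> u < t \<Longrightarrow> alg.open_jobs u = alg.open_jobs s"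
    and steadyO: "\<And>u. s \<le> u \<Longrightarrow> u < t \<Longrightarrow> opt.open_jobs u = opt.open_jobs s"
  shows "amortized s t"
proof -
  define V where "V = integral {s..t} opt.total_speed"
  define e where "e = (t - s) * (real m * P (V / (t - s) / real m))"
  have V0: "0 \<le> V" unfolding V_def
    by (intro integral_nonneg opt.total_integrable opt.total_speed_nonneg)
  have e0: "0 \<le> e" using st V0 by (auto simp: e_def intro!: mult_nonneg_nonneg alg.P_nonneg divide_nonneg_nonneg)
  have s1: "0 < Pinv P 1" by (intro alg.Pinv_pos) simp
  have IA: "(\<integral>\<^sup>+x\<in>{s..<t}. ennreal (real (nA x)) \<partial>lborel) = ennreal ((t - s) * real (nA s))"
  proof (rule nn_integral_Ico_const)
    fix x assume "x \<in> {s..<t}"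
    then have "alg.open_jobs x = alg.open_jobs s" by (intro steadyA) auto
    then show "ennreal (real (nA x)) = ennreal (real (nA s))" by simp
  qed (use st in auto)
  have IO: "(\<integral>\<^sup>+x\<in>{s..<t}. ennreal (real (nO x)) \<partial>lborel) = ennreal ((t - s) * real (nO s))"
  proof (rule nn_integral_Ico_const)
    fix x assume "x \<in> {s..<t}"
    then have "opt.open_jobs x = opt.open_jobs s" by (intro steadyO) auto
    then show "ennreal (real (nO x)) = ennreal (real (nO s))" by simp
  qed (use st in auto)
  have IS: "(\<integral>\<^sup>+x\<in>{s..<t}. ennreal (alg.total_speed x) \<partial>lborel) = ennreal ((t - s) * alg.total_speed s)"
  proof (rule nn_integral_Ico_const)
    fix x assume "x \<in> {s..<t}"
    then show "ennreal (alg.total_speed x) = ennreal (alg.total_speed s)"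
      using steadyA[of x] unfolding alg.total_speed_eq by (simp del: of_nat_min)
  qed (use st alg.total_speed_nonneg in auto)
  have IP: "ennreal e \<le> (\<integral>\<^sup>+x\<in>{s..<t}. ennreal (opt.total_power x) \<partial>lborel)"
    unfolding e_def V_def by (rule opt.power_ge_at_mean_speed[OF st])
  have r: "0 \<le> ratio" "0 \<le> ratio / Pinv P 1" using ratio_ge_1 s1 by auto
  have nn: "0 \<le> (t - s) * real (nA s)" "0 \<le> (t - s) * real (nO s)" "0 \<le> (t - s) * alg.total_speed s"
    using st alg.total_speed_nonneg[of s] by auto
  have "ennreal (potential t) + ennreal ((t - s) * real (nA s)) = ennreal (potential t + (t - s) * real (nA s))"
    using nn potential_nonneg by (simp add: ennreal_plus)
  also have "\<dots> \<le> ennreal (potential s + ratio * ((t - s) * real (nO s) + e)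
     + ratio / Pinv P 1 * ((t - s) * alg.total_speed s))"
    unfolding e_def V_def by (intro ennreal_leI potential_drift st arrivals steadyA)
  also have "\<dots> = ennreal (potential s) + ennreal ratio * (ennreal ((t - s) * real (nO s)) + ennreal e)
     + ennreal (ratio / Pinv P 1) * ennreal ((t - s) * alg.total_speed s)"
  proof -
    have "0 \<le> ratio * ((t - s) * real (nO s) + e)" "0 \<le> ratio / Pinv P 1 * ((t - s) * alg.total_speed s)"
      by (rule mult_nonneg_nonneg[OF r(1) add_nonneg_nonneg[OF nn(2) e0]],
          rule mult_nonneg_nonneg[OF r(2) nn(3)])
    then show ?thesis
      using potential_nonneg[of s] nn e0 r
      by (simp only: ennreal_plus add_nonneg_nonneg ennreal_mult)
  qed
  also have "\<dots> \<le> ennreal (potential s)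
       + ennreal ratio * (ennreal ((t - s) * real (nO s)) + (\<integral>\<^sup>+x\<in>{s..<t}. ennreal (opt.total_power x) \<partial>lborel))
       + ennreal (ratio / Pinv P 1) * ennreal ((t - s) * alg.total_speed s)"
    by (intro add_mono mult_left_mono IP) auto
  finally show ?thesis unfolding amortized_def IA IO IS .
qed

lemma amortized_trans:
  assumes st: "s < t" "t < u" and "amortized s t" "amortized t u"
  shows "amortized s u"
proof -
  have meas: "(\<lambda>x. ennreal (real (nA x))) \<in> borel_measurable borel"
    "(\<lambda>x. ennreal (real (nO x))) \<in> borel_measurable borel"
    "(\<lambda>x. ennreal (opt.total_power x)) \<in> borel_measurable borel"
    "(\<lambda>x. ennreal (alg.total_speed x)) \<in> borel_measurable borel"
    using measurable_compose[OF alg.card_open_jobs_measurable measurable_ennreal]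
      measurable_compose[OF opt.card_open_jobs_measurable measurable_ennreal]
      measurable_compose[OF opt.total_power_measurable measurable_ennreal]
      measurable_compose[OF alg.total_speed_measurable measurable_ennreal] by auto
  note split = meas[THEN nn_integral_Ico_split, of s t u, OF less_imp_le[OF st(1)] less_imp_le[OF st(2)]]
  define I where "I f x y = (\<integral>\<^sup>+z\<in>{x..<y}. f z \<partial>lborel)" for f :: "real \<Rightarrow> ennreal" and x y :: real
  define R where "R x y = ennreal ratio * (I (\<lambda>x. ennreal (real (nO x))) x y + I (\<lambda>x. ennreal (opt.total_power x)) x y)
     + ennreal (ratio / Pinv P 1) * I (\<lambda>x. ennreal (alg.total_speed x)) x y" for x y
  define N where "N x y = I (\<lambda>x. ennreal (real (nA x))) x y" for x y
  have amort: "amortized x y \<longleftrightarrow> ennreal (potential y) + N x y \<le> ennreal (potential x) + R x y" for x y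
    by (simp add: amortized_def R_def N_def I_def add.assoc)
  have N: "N s u = N s t + N t u" unfolding N_def I_def by (rule split)
  have R: "R s u = R s t + R t u" unfolding R_def I_def split by (simp add: algebra_simps)
  have "ennreal (potential u) + N s u = (ennreal (potential u) + N t u) + N s t"
    unfolding N by (simp add: add_ac)
  also have "\<dots> \<le> (ennreal (potential t) + R t u) + N s t"
    using \<open>amortized t u\<close> unfolding amort by (rule add_right_mono)
  also have "\<dots> = (ennreal (potential t) + N s t) + R t u" by (simp add: add_ac)
  also have "\<dots> \<le> (ennreal (potential s) + R s t) + R t u"
    using \<open>amortized s t\<close> unfolding amort by (rule add_right_mono)
  also have "\<dots> = ennreal (potential s) + R s u" unfolding R by (simp add: add_ac)
  finally show ?thesis unfolding amort .
qed

lemma amortized_always: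
  assumes "s < t"
  shows "amortized s t"
proof -
  obtain EA where EA: "finite EA" "a ` J \<subseteq> EA"
    "\<And>s t u. s \<le> u \<Longrightarrow> u < t \<Longrightarrow> EA \<inter> {s<..<t} = {} \<Longrightarrow> alg.open_jobs u = alg.open_jobs s"
    using alg.exists_events by blast
  obtain EO where EO: "finite EO" "a ` J \<subseteq> EO"
    "\<And>s t u. s \<le> u \<Longrightarrow> u < t \<Longrightarrow> EO \<inter> {s<..<t} = {} \<Longrightarrow> opt.open_jobs u = opt.open_jobs s"
    using opt.exists_events by blast
  show ?thesis
  proof (rule interval_chain[of "EA \<union> EO", OF _ amortized_trans _ assms])
    fix s t :: real assume st: "s < t" "(EA \<union> EO) \<inter> {s<..<t} = {}"
    then have none: "EA \<inter> {s<..<t} = {}" "EO \<inter> {s<..<t} = {}" by auto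
    show "amortized s t"
    proof (rule amortized_between_events[OF st(1)])
      show "a ` J \<inter> {s<..<t} = {}" using none EA(2) by blast
      fix u assume "s \<le> u" "u < t"
      then show "alg.open_jobs u = alg.open_jobs s" "opt.open_jobs u = opt.open_jobs s"
        by (rule EA(3)[OF _ _ none(1)], rule EO(3)[OF _ _ none(2)])
    qed
  qed (use EA EO in auto)
qed

lemma potential_before_releases: "(\<And>j. j \<in> J \<Longrightarrow> t < a j) \<Longrightarrow> potential t = 0"
proof -
  assume early: "\<And>j. j \<in> J \<Longrightarrow> t < a j"
  then have "alg.released t = {}" by (force simp: alg.released_def)
  moreover have "bottom_work {} r i = 0" for r :: "'j \<Rightarrow> real" and i
    by (rule bottom_work_eq_0) auto
  then have "excess {} r p k \<le> 0" for r p :: "'j \<Rightarrow> real" and k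
    by (subst excess_le_iff) auto
  ultimately have "potential t \<le> 0"
    unfolding potential_def using increment_nonneg by (intro sum_nonpos mult_nonneg_nonpos) auto
  with potential_nonneg[of t] show ?thesis by simp
qed

lemma alg_work_le_total_size:
  assumes "\<And>j. j \<in> J \<Longrightarrow> s < a j"
  shows "(\<integral>\<^sup>+x\<in>{s..<t}. ennreal (alg.total_speed x) \<partial>lborel) \<le> ennreal (\<Sum>j\<in>J. w j)"
proof -
  \<comment> \<open>Equality holds because the speed of the algorithm is entirely spent on the
    served jobs; idle servers have speed 0.\<close>
  have total: "alg.total_speed x = (\<Sum>j\<in>J. alg.job_rate j x)" for x
  proof -
    have "J \<inter> alg.serving x = alg.serving x"
      using alg.serving_subset[of x] alg.open_jobs_subset[of x] by auto
    then have "(\<Sum>j\<in>J. alg.job_rate j x) = real (card (alg.serving x)) * alg.speed x"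
      unfolding alg.rate_eq using alg.finite_jobs by (simp add: sum.If_cases)
    then show ?thesis unfolding alg.total_speed_eq alg.card_serving by simp
  qed
  have "(\<integral>\<^sup>+x\<in>{s..<t}. ennreal (alg.total_speed x) \<partial>lborel)
      \<le> (\<integral>\<^sup>+x. (\<Sum>j\<in>J. ennreal (alg.job_rate j x) * indicator {a j..t} x) \<partial>lborel)"
  proof (rule nn_integral_mono)
    fix x
    have "ennreal (alg.total_speed x) * indicator {s..<t} x = (\<Sum>j\<in>J. ennreal (alg.job_rate j x) * indicator {s..<t} x)"
    proof -
      have "ennreal (alg.total_speed x) = (\<Sum>j\<in>J. ennreal (alg.job_rate j x))"
        unfolding total by (rule sum_ennreal[symmetric]) (rule alg.rate_nonneg)
      then show ?thesis by (simp add: sum_distrib_right)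
    qed
    also have "\<dots> \<le> (\<Sum>j\<in>J. ennreal (alg.job_rate j x) * indicator {a j..t} x)"
      using alg.rate_before_release[of x] by (intro sum_mono) (auto split: split_indicator simp: not_le)
    finally show "ennreal (alg.total_speed x) * indicator {s..<t} x
        \<le> (\<Sum>j\<in>J. ennreal (alg.job_rate j x) * indicator {a j..t} x)" .
  qed
  also have "\<dots> = (\<Sum>j\<in>J. \<integral>\<^sup>+x\<in>{a j..t}. ennreal (alg.job_rate j x) \<partial>lborel)"
    using alg.rate_measurable by (intro nn_integral_sum) auto
  also have "\<dots> \<le> (\<Sum>j\<in>J. ennreal (w j))"
    unfolding alg.rate_nn_integral alg.work_def[symmetric]
    by (intro sum_mono ennreal_leI alg.work_le_size)
  also have "\<dots> = ennreal (\<Sum>j\<in>J. w j)"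
    using alg.size_pos by (intro sum_ennreal) (auto intro: less_imp_le)
  finally show ?thesis .
qed

text \<open>The potential is 0 before the first release and never negative, so it drops out. The
  speed integral is at most the total size, hence at most the competitor's cost. The bound is
  uniform in the right endpoint and passes to the limit by monotone convergence.\<close>

lemma flow_time_bound:
  "(\<integral>\<^sup>+x. ennreal (real (nA x)) \<partial>lborel) \<le> ennreal (ratio * (1 + 1 / Pinv P 1)) * cost P m J a w sp asg"
    (is "_ \<le> ?bound")
proof -
  define t0 where "t0 = (if J = {} then 0 else Min (a ` J) - 1)"
  have early: "t0 < a j" if "j \<in> J" for j
  proof -
    have "Min (a ` J) \<le> a j" using that alg.finite_jobs by (intro Min_le) auto
    then show ?thesis using that by (auto simp: t0_def)
  qed
  have s1: "0 < Pinv P 1" by (intro alg.Pinv_pos) simp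
  have bound: "(\<integral>\<^sup>+x\<in>{t0..<t}. ennreal (real (nA x)) \<partial>lborel) \<le> ?bound" if "t0 < t" for t
  proof -
    have "(\<integral>\<^sup>+x\<in>{t0..<t}. ennreal (real (nA x)) \<partial>lborel)
        \<le> ennreal (potential t) + (\<integral>\<^sup>+x\<in>{t0..<t}. ennreal (real (nA x)) \<partial>lborel)" by simp
    also have "\<dots> \<le> ennreal (potential t0)
       + ennreal ratio * ((\<integral>\<^sup>+x\<in>{t0..<t}. ennreal (real (nO x)) \<partial>lborel)
           + (\<integral>\<^sup>+x\<in>{t0..<t}. ennreal (opt.total_power x) \<partial>lborel))
       + ennreal (ratio / Pinv P 1) * (\<integral>\<^sup>+x\<in>{t0..<t}. ennreal (alg.total_speed x) \<partial>lborel)"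
      using amortized_always[OF that] unfolding amortized_def .
    also have "\<dots> \<le> 0 + ennreal ratio * cost P m J a w sp asg + ennreal (ratio / Pinv P 1) * cost P m J a w sp asg"
    proof (intro add_mono mult_left_mono)
      show "ennreal (potential t0) \<le> 0" using potential_before_releases[OF early] by simp
      show "(\<integral>\<^sup>+x\<in>{t0..<t}. ennreal (real (nO x)) \<partial>lborel)
          + (\<integral>\<^sup>+x\<in>{t0..<t}. ennreal (opt.total_power x) \<partial>lborel) \<le> cost P m J a w sp asg"
        unfolding cost_def by (intro add_mono nn_integral_mono) (auto split: split_indicator)
      show "(\<integral>\<^sup>+x\<in>{t0..<t}. ennreal (alg.total_speed x) \<partial>lborel) \<le> cost P m J a w sp asg"
        using alg_work_le_total_size[OF early] opt.total_size_le_cost by (rule order_trans)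
    qed auto
    also have "\<dots> = (ennreal ratio + ennreal (ratio / Pinv P 1)) * cost P m J a w sp asg"
      by (simp add: distrib_right)
    also have "ennreal ratio + ennreal (ratio / Pinv P 1) = ennreal (ratio * (1 + 1 / Pinv P 1))"
      using ratio_ge_1 s1 by (subst ennreal_plus[symmetric]) (auto simp: algebra_simps)
    finally show ?thesis .
  qed
  define f where "f i x = ennreal (real (nA x)) * indicator {t0..<t0 + real (Suc i)} x" for i x
  have "(\<integral>\<^sup>+x. ennreal (real (nA x)) \<partial>lborel) \<le> (\<integral>\<^sup>+x. (SUP i. f i x) \<partial>lborel)"
  proof (rule nn_integral_mono)
    fix x
    show "ennreal (real (nA x)) \<le> (SUP i. f i x)"
    proof (cases "x < t0")
      case True
      then have "alg.open_jobs x = {}" using early by (force simp: alg.open_jobs_iff)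
      then show ?thesis by simp
    next
      case False
      obtain i where "x - t0 < real i" using reals_Archimedean2 by blast
      then have "f i x = ennreal (real (nA x))" using False by (auto simp: f_def)
      then show ?thesis by (metis SUP_upper UNIV_I)
    qed
  qed
  also have "\<dots> = (SUP i. \<integral>\<^sup>+x. f i x \<partial>lborel)"
  proof (rule nn_integral_monotone_convergence_SUP)
    show "incseq f" unfolding f_def by (auto simp: incseq_def le_fun_def split: split_indicator)
    show "f i \<in> borel_measurable lborel" for i
      unfolding f_def using measurable_compose[OF alg.card_open_jobs_measurable measurable_ennreal] by simp
  qed
  also have "\<dots> \<le> ?bound" unfolding f_def by (intro SUP_least bound) simp
  finally show ?thesis .
qed

lemma alg_cost_bound:
  "cost P m J a w spA asgA \<le> ennreal (ratio * (2 + 2 / Pinv P 1)) * cost P m J a w sp asg"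
proof -
  have s1: "0 < Pinv P 1" by (intro alg.Pinv_pos) simp
  have "cost P m J a w spA asgA = 2 * (\<integral>\<^sup>+x. ennreal (real (nA x)) \<partial>lborel)"
    unfolding cost_def alg.total_power_eq by (simp add: mult_2)
  also have "\<dots> \<le> 2 * (ennreal (ratio * (1 + 1 / Pinv P 1)) * cost P m J a w sp asg)"
    by (intro mult_left_mono flow_time_bound) auto
  also have "\<dots> = ennreal (2 * (ratio * (1 + 1 / Pinv P 1))) * cost P m J a w sp asg"
    using ratio_ge_1 s1 by (subst ennreal_mult) (auto simp: mult.assoc)
  also have "2 * (ratio * (1 + 1 / Pinv P 1)) = ratio * (2 + 2 / Pinv P 1)" by (simp add: algebra_simps)
  finally show ?thesis .
qed

end

theorem theorem1:
  fixes P :: "real \<Rightarrow> real" and m :: nat and J :: "'j set"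
    and a w :: "'j \<Rightarrow> real"
    and spA :: "nat \<Rightarrow> real \<Rightarrow> real" and asgA :: "nat \<Rightarrow> real \<Rightarrow> 'j option"
  assumes "power_fun_ok P"
    and "m \<ge> 1"
    and "finite J"
    and "\<forall>j\<in>J. w j > 0"
    and "alg_schedule P m J a w spA asgA"
  shows "\<forall>sp asg. feasible m J a sp asg \<longrightarrow>
           cost P m J a w spA asgA
             \<le> ennreal (P (2 - 1 / real m) * (2 + 2 / Pinv P 1 * max 1 (P (sbar P))))
                 * cost P m J a w sp asg"
proof (intro allI impI)
  fix sp :: "nat \<Rightarrow> real \<Rightarrow> real" and asg :: "nat \<Rightarrow> real \<Rightarrow> 'j option"
  assume feas: "feasible m J a sp asg"
  interpret power_function P by unfold_locales fact
  have s1: "0 < Pinv P 1" by (rule Pinv_pos) simp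
  have ratio: "1 \<le> P (2 - 1 / real m)" by (rule P_two_minus_ge) fact
  let ?c = "P (2 - 1 / real m) * (2 + 2 / Pinv P 1 * max 1 (P (sbar P)))"
  \<comment> \<open>The maximum is at least 1, so the constant of \<open>alg_cost_bound\<close> is
    at most the claimed one.\<close>
  have "2 / Pinv P 1 * 1 \<le> 2 / Pinv P 1 * max 1 (P (sbar P))" using s1 by (intro mult_left_mono) auto
  then have c: "P (2 - 1 / real m) * (2 + 2 / Pinv P 1) \<le> ?c" using ratio by (intro mult_left_mono) auto
  have "0 < P (2 - 1 / real m) * (2 + 2 / Pinv P 1)" using ratio s1 by (intro mult_pos_pos add_pos_pos) auto
  with c have c_pos: "0 < ?c" by linarith
  show "cost P m J a w spA asgA \<le> ennreal ?c * cost P m J a w sp asg"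
  \<comment> \<open>For infinite cost the right side is infinite only because the constant is
    positive, as 0 times infinity is 0 in \<open>ennreal\<close>. Finite cost means finite energy,
    which supplies the local integrability needed for the competitor.\<close>
  proof (cases "cost P m J a w sp asg = \<infinity>")
    case True
    have "0 < ennreal ?c" using c_pos by (simp only: ennreal_less_zero_iff)
    then have "ennreal ?c * cost P m J a w sp asg = \<infinity>"
      unfolding True by (simp only: infinity_ennreal_def ennreal_mult_eq_top_iff) auto
    then show ?thesis by simp
  next
    case False
    then have fin: "(\<integral>\<^sup>+t. ennreal (\<Sum>k<m. P (sp k t)) \<partial>lborel) < \<infinity>"
      by (auto simp: cost_def less_top)
    obtain \<Delta> where \<Delta>: "amortizes m \<Delta>" using amortizes_exists assms(2) by blast
    interpret srpt_vs_schedule P m J a w spA asgA sp asg \<Delta>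
    proof unfold_locales
      show "feasible m J a spA asgA" using assms(5) by (simp add: alg_schedule_def)
      show "(\<integral>\<^sup>+x\<in>{u..v}. ennreal (\<Sum>k<m. spA k x) \<partial>lborel) < \<infinity>" for u v
        using assms by (intro alg_locally_finite)
      show "(\<integral>\<^sup>+x\<in>{u..v}. ennreal (\<Sum>k<m. sp k x) \<partial>lborel) < \<infinity>" for u v
        using feas fin by (rule finite_power_imp_locally_finite)
    qed (use assms feas \<Delta> in auto)
    have "cost P m J a w spA asgA
        \<le> ennreal (P (2 - 1 / real m) * (2 + 2 / Pinv P 1)) * cost P m J a w sp asg"
      by (rule alg_cost_bound)
    also have "\<dots> \<le> ennreal ?c * cost P m J a w sp asg"
      by (intro mult_right_mono ennreal_leI c) auto
    finally show ?thesis .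
  qed
qed

end
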